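(* Let $r\ge 0$ and $i\in\{Lu,Nu\}$. Suppose the reference user is connected to its central UAV, which is at horizontal distance $r$ and has channel type $i$. Then the Laplace transform $\mathcal{L}_I^c(s,i,r)=\mathbb{E}[\exp(-sI)]$ of the interference $I$ experienced at the reference user is $$\mathcal{L}_{I}^c(s,i,r)= \prod_{j\in \mathcal{C}} \exp\left(-2\pi \int_{f_i^j(r)}^{\infty} \left(1-\left(\frac{m_j}{m_j+s\rho_j \eta_j (x^2+h_j^2)^{-\alpha_j/2}}\right)^{m_j} \right)\lambda_j(x)\,x\, dx\right).$$
   Context: The reference user is at the origin of $\mathbb{R}^2$; all distances are horizontal. Let $\mathcal{C}=\{Lu,Nu,Lb,Nb\}$ (line-of-sight (LOS) UAV, non-LOS (NLOS) UAV, LOS terrestrial base station (TBS), NLOS TBS). For $j\in\mathcal{C}$ the positive parameters are: transmit power $\rho_j$ ($\rho_{Lu}=\rho_{Nu}$, $\rho_{Lb}=\rho_{Nb}$), additional path loss $\eta_j$, path loss exponent $\alpha_j$, height $h_j$ ($h_{Lu}=h_{Nu}=h$, $h_{Lb}=h_{Nb}=h_b$), and Nakagami fading parameter $m_j$. LOS probabilities: $\mathcal{P}_{i}(r)=-a\exp(-b\arctan(h_i/r))+c$ for $i\in\{Lu,Lb\}$, $\mathcal{P}_{Nu}=1-\mathcal{P}_{Lu}$, $\mathcal{P}_{Nb}=1-\mathcal{P}_{Lb}$, with environment constants $a,b,c$. The reference user has one associated "central UAV". The other UAVs are modelled as a homogeneous Poisson point process (PPP) $\Phi_u$ of density $\lambda_u$,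 and the TBSs as an independent homogeneous PPP $\Phi_b$ of density $\lambda_b$. Thinning by the LOS probabilities splits these into independent PPPs $\Phi_{Lu},\Phi_{Nu},\Phi_{Lb},\Phi_{Nb}$ with densities at distance $r$ given by $\lambda_i(r)=\lambda_u\mathcal{P}_i(r)$ for $i\in\{Lu,Nu\}$ and $\lambda_i(r)=\lambda_b\mathcal{P}_i(r)$ for $i\in\{Lb,Nb\}$. The instantaneous power received from a node of type $j$ at distance $x$ is $\mathcal{R}_j(x)=\rho_j\eta_j(x^2+h_j^2)^{-\alpha_j/2}G_j$, where the fading gain $G_j$ is Gamma distributed with shape $m_j$ and mean $1$, independent across nodes (Nakagami-$m$ fading for UAVs; Rayleigh fading, used for TBSs, is $m_j=1$). The average received power is $\overline{\mathcal{R}}_j(x)=\rho_j\eta_j(x^2+h_j^2)^{-\alpha_j/2}$. The user connects to the node (central UAV, other UAV, or TBS) providing the largest average received power. The interference $I$ is the sum of the instantaneous powers received from all nodes other than the serving one. For $i,j\in\mathcal{C}$ define $f_i^j(r)=\sqrt{\max\left(0,\left(\frac{\rho_j\eta_j}{\rho_i\eta_i}\right)^{2/\alpha_j}(h_i^2+r^2)^{\alpha_i/\alpha_j}-h_j^2\right)}$. *)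

theory Defs
  imports "HOL-Probability.Probability"
begin

datatype channel = Lu | Nu | Lb | Nb

datatype tier = UAV | TBS

fun tier_of :: "channel \<Rightarrow> tier" where
  "tier_of Lu = UAV" | "tier_of Nu = UAV" | "tier_of Lb = TBS" | "tier_of Nb = TBS"

fun los :: "tier \<Rightarrow> channel" where
  "los UAV = Lu" | "los TBS = Lb"

fun nlos :: "tier \<Rightarrow> channel" where
  "nlos UAV = Nu" | "nlos TBS = Nb"

record network =
  tx_power :: "channel \<Rightarrow> real"
  path_loss :: "channel \<Rightarrow> real"
  ple :: "channel \<Rightarrow> real"
  height :: "channel \<Rightarrow> real"
  nakagami :: "channel \<Rightarrow> real"
  env_a :: real
  env_b :: real
  env_c :: real
  intensity :: "tier \<Rightarrow> real"

text \<open>The elevation angle \<open>arctan (h / x)\<close>. At \<open>x = 0\<close>, where HOL has \<open>h / 0 = 0\<close>, it is given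
  its limit \<open>pi / 2\<close>.\<close>

definition elevation :: "real \<Rightarrow> real \<Rightarrow> real" where
  "elevation h x = (if x = 0 then pi / 2 else arctan (h / x))"

definition los_prob :: "network \<Rightarrow> tier \<Rightarrow> real \<Rightarrow> real" where
  "los_prob P t x = - env_a P * exp (- env_b P * elevation (height P (los t)) x) + env_c P"

definition channel_prob :: "network \<Rightarrow> channel \<Rightarrow> real \<Rightarrow> real" where
  "channel_prob P j x =
     (if j = los (tier_of j) then los_prob P (tier_of j) x else 1 - los_prob P (tier_of j) x)"

definition channel_intensity :: "network \<Rightarrow> channel \<Rightarrow> real \<Rightarrow> real" where
  "channel_intensity P j x = intensity P (tier_of j) * channel_prob P j x"

definition mean_power :: "network \<Rightarrow> channel \<Rightarrow> real \<Rightarrow> real" where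
  "mean_power P j x = tx_power P j * path_loss P j * (x\<^sup>2 + (height P j)\<^sup>2) powr (- ple P j / 2)"

definition excl_dist :: "network \<Rightarrow> channel \<Rightarrow> channel \<Rightarrow> real \<Rightarrow> real" where
  "excl_dist P i j r =
     sqrt (max 0 (((tx_power P j * path_loss P j) / (tx_power P i * path_loss P i)) powr (2 / ple P j)
                   * ((height P i)\<^sup>2 + r\<^sup>2) powr (ple P i / ple P j) - (height P j)\<^sup>2))"

text \<open>The Gamma density with shape \<open>k\<close> and rate \<open>\<beta>\<close>; its mean is \<open>k / \<beta>\<close>.\<close>

definition gamma_density :: "real \<Rightarrow> real \<Rightarrow> real \<Rightarrow> real" where
  "gamma_density k \<beta> x =
     (if x \<le> 0 then 0 else \<beta> powr k * x powr (k - 1) * exp (- \<beta> * x) / Gamma k)"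

text \<open>A homogeneous Poisson point process of positive density on the plane, given by an
  enumeration \<open>X 0, X 1, \<dots>\<close> of its points (almost surely there are infinitely many).\<close>

definition point_count :: "(nat \<Rightarrow> 'w \<Rightarrow> real ^ 2) \<Rightarrow> (real ^ 2) set \<Rightarrow> 'w \<Rightarrow> nat" where
  "point_count X B \<omega> = card {n. X n \<omega> \<in> B}"

definition homogeneous_PPP :: "'w measure \<Rightarrow> real \<Rightarrow> (nat \<Rightarrow> 'w \<Rightarrow> real ^ 2) \<Rightarrow> bool" where
  "homogeneous_PPP M d X \<longleftrightarrow>
     (\<forall>n. X n \<in> borel_measurable M) \<and>
     (AE \<omega> in M. \<forall>B. bounded B \<longrightarrow> finite {n. X n \<omega> \<in> B}) \<and>
     (\<forall>B k. B \<in> sets borel \<and> bounded B \<longrightarrow>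
        measure M {\<omega> \<in> space M. point_count X B \<omega> = k}
          = (d * measure lborel B) ^ k / fact k * exp (- (d * measure lborel B))) \<and>
     (\<forall>K (B :: nat \<Rightarrow> (real ^ 2) set).
        finite K \<and> disjoint_family_on B K \<and> (\<forall>k\<in>K. B k \<in> sets borel \<and> bounded (B k)) \<longrightarrow>
        prob_space.indep_vars M (\<lambda>_. count_space UNIV) (\<lambda>k. point_count X (B k)) K)"

datatype node = Central | Node tier nat

text \<open>The sources of randomness: the positions of each tier, one blockage variable per
  non-central node, and the fading gains. The blockage variable \<open>U t n\<close> is uniform on \<open>[0, 1]\<close>, and
  node \<open>n\<close> of tier \<open>t\<close> is LOS iff \<open>U t n\<close> is at most its LOS probability: this is the independent
  position-dependent thinning. For each channel type \<open>j\<close> a node \<open>v\<close> has a gain \<open>G j v\<close>, of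
  which only the one for the node's actual type is used.\<close>

datatype source = Position tier | Blockage tier nat | Fading channel node

fun source_sets ::
  "'w measure \<Rightarrow> (tier \<Rightarrow> nat \<Rightarrow> 'w \<Rightarrow> real ^ 2) \<Rightarrow> (tier \<Rightarrow> nat \<Rightarrow> 'w \<Rightarrow> real) \<Rightarrow>
    (channel \<Rightarrow> node \<Rightarrow> 'w \<Rightarrow> real) \<Rightarrow> source \<Rightarrow> 'w set set" where
  "source_sets M X U G (Position t) =
     sets (vimage_algebra (space M) (\<lambda>\<omega> n. X t n \<omega>) (\<Pi>\<^sub>M n\<in>UNIV. borel))"
| "source_sets M X U G (Blockage t n) = sets (vimage_algebra (space M) (U t n) borel)"
| "source_sets M X U G (Fading j v) = sets (vimage_algebra (space M) (G j v) borel)"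

locale uav_network = prob_space M
  for P :: network
    and M :: "'w measure"
    and X :: "tier \<Rightarrow> nat \<Rightarrow> 'w \<Rightarrow> real ^ 2"
    and U :: "tier \<Rightarrow> nat \<Rightarrow> 'w \<Rightarrow> real"
    and G :: "channel \<Rightarrow> node \<Rightarrow> 'w \<Rightarrow> real" +
  assumes tx_power_pos: "tx_power P j > 0"
    and path_loss_pos: "path_loss P j > 0"
    and ple_pos: "ple P j > 0"
    and height_pos: "height P j > 0"
    and nakagami_pos: "nakagami P j > 0"
    and intensity_pos: "intensity P t > 0"
    and tx_power_tier: "tx_power P (los t) = tx_power P (nlos t)"
    and height_tier: "height P (los t) = height P (nlos t)"
    and los_prob_range: "x \<ge> 0 \<Longrightarrow> los_prob P t x \<in> {0..1}"
    and positions: "homogeneous_PPP M (intensity P t) (X t)"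
    and blockage: "distributed M lborel (U t n) (indicator {0..1})"
    and fading: "distributed M lborel (G j v) (gamma_density (nakagami P j) (nakagami P j))"
    and indep_sources: "indep_sets (source_sets M X U G) UNIV"

text \<open>Below, \<open>r\<close> and \<open>i\<close> are the distance and the channel type of the central UAV.\<close>

fun node_dist :: "(tier \<Rightarrow> nat \<Rightarrow> 'w \<Rightarrow> real ^ 2) \<Rightarrow> real \<Rightarrow> node \<Rightarrow> 'w \<Rightarrow> real" where
  "node_dist X r Central \<omega> = r"
| "node_dist X r (Node t n) \<omega> = norm (X t n \<omega>)"

fun node_channel ::
  "network \<Rightarrow> (tier \<Rightarrow> nat \<Rightarrow> 'w \<Rightarrow> real ^ 2) \<Rightarrow> (tier \<Rightarrow> nat \<Rightarrow> 'w \<Rightarrow> real) \<Rightarrow> channel \<Rightarrow>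
    node \<Rightarrow> 'w \<Rightarrow> channel" where
  "node_channel P X U i Central \<omega> = i"
| "node_channel P X U i (Node t n) \<omega> =
     (if U t n \<omega> \<le> los_prob P t (norm (X t n \<omega>)) then los t else nlos t)"

definition node_mean_power ::
  "network \<Rightarrow> (tier \<Rightarrow> nat \<Rightarrow> 'w \<Rightarrow> real ^ 2) \<Rightarrow> (tier \<Rightarrow> nat \<Rightarrow> 'w \<Rightarrow> real) \<Rightarrow> channel \<Rightarrow> real \<Rightarrow>
    node \<Rightarrow> 'w \<Rightarrow> real" where
  "node_mean_power P X U i r v \<omega> = mean_power P (node_channel P X U i v \<omega>) (node_dist X r v \<omega>)"

definition node_power ::
  "network \<Rightarrow> (tier \<Rightarrow> nat \<Rightarrow> 'w \<Rightarrow> real ^ 2) \<Rightarrow> (tier \<Rightarrow> nat \<Rightarrow> 'w \<Rightarrow> real) \<Rightarrow>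
    (channel \<Rightarrow> node \<Rightarrow> 'w \<Rightarrow> real) \<Rightarrow> channel \<Rightarrow> real \<Rightarrow> node \<Rightarrow> 'w \<Rightarrow> real" where
  "node_power P X U G i r v \<omega> =
     node_mean_power P X U i r v \<omega> * G (node_channel P X U i v \<omega>) v \<omega>"

definition serves ::
  "network \<Rightarrow> (tier \<Rightarrow> nat \<Rightarrow> 'w \<Rightarrow> real ^ 2) \<Rightarrow> (tier \<Rightarrow> nat \<Rightarrow> 'w \<Rightarrow> real) \<Rightarrow> channel \<Rightarrow> real \<Rightarrow>
    node \<Rightarrow> 'w \<Rightarrow> bool" where
  "serves P X U i r v \<omega> \<longleftrightarrow>
     (\<forall>w. node_mean_power P X U i r w \<omega> \<le> node_mean_power P X U i r v \<omega>)"

text \<open>The interference when \<open>v\<close> serves. It takes values in \<open>[0, \<infinity>]\<close>, since no path loss exponent is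
  assumed to exceed \<open>2\<close>.\<close>

definition interference ::
  "network \<Rightarrow> (tier \<Rightarrow> nat \<Rightarrow> 'w \<Rightarrow> real ^ 2) \<Rightarrow> (tier \<Rightarrow> nat \<Rightarrow> 'w \<Rightarrow> real) \<Rightarrow>
    (channel \<Rightarrow> node \<Rightarrow> 'w \<Rightarrow> real) \<Rightarrow> channel \<Rightarrow> real \<Rightarrow> node \<Rightarrow> 'w \<Rightarrow> ennreal" where
  "interference P X U G i r v \<omega> =
     (\<integral>\<^sup>+ w. ennreal (node_power P X U G i r w \<omega>) \<partial>count_space (- {v}))"

text \<open>The function \<open>t \<mapsto> exp (- t)\<close> on \<open>[0, \<infinity>]\<close>.\<close>

definition exp_neg :: "ennreal \<Rightarrow> real" where
  "exp_neg t = (if t = \<infinity> then 0 else exp (- enn2real t))"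

definition laplace_transform :: "'w measure \<Rightarrow> ('w \<Rightarrow> ennreal) \<Rightarrow> real \<Rightarrow> real" where
  "laplace_transform M Y s = (\<integral>\<omega>. exp_neg (ennreal s * Y \<omega>) \<partial>M)"

end

theory Submission
  imports Defs
begin

text \<open>Give every node other than the central UAV a penalty: \<open>s\<close> times its received power if its mean
  power does not exceed that of the central UAV, and \<open>\<infinity>\<close> otherwise. Then \<open>exp (- total penalty)\<close> is
  \<open>exp (- s I)\<close> on the event that the central UAV serves and \<open>0\<close> elsewhere, so the Laplace transform
  is the quotient of its expectations at \<open>s\<close> and at \<open>0\<close>. Conditionally on the positions the penalties
  are independent; averaging over blockage and fading replaces the penalty of a node at \<open>x\<close> by a
  deterministic factor \<open>g (norm x)\<close>. The expectation of the product of these factors is the Laplace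
  functional of the Poisson process, \<open>exp (- \<lambda> \<integral>(1 - g (norm x)) dx)\<close>. In polar coordinates, and
  split by channel type, the exponent is an integral over distances below the exclusion distance, where
  \<open>g\<close> vanishes, plus the integral in the claim. The former does not depend on \<open>s\<close> and cancels.\<close>

subsection \<open>The exponential on the extended half-line\<close>

lemma exp_neg_ennreal: "0 \<le> a \<Longrightarrow> exp_neg (ennreal a) = exp (- a)"
  by (simp add: exp_neg_def)

lemma exp_neg_simps [simp]: "exp_neg 0 = 1" "exp_neg \<top> = 0"
  by (simp_all add: exp_neg_def)

lemma exp_neg_nonneg [simp]: "0 \<le> exp_neg a"
  by (simp add: exp_neg_def)

lemma exp_neg_le_1 [simp]: "exp_neg a \<le> 1"
  by (simp add: exp_neg_def)

lemma exp_neg_antimono: "a \<le> b \<Longrightarrow> exp_neg b \<le> exp_neg a"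
  by (cases a; cases b) (auto simp: exp_neg_ennreal top_unique)

lemma exp_neg_add: "exp_neg (a + b) = exp_neg a * exp_neg b"
  by (cases a; cases b) (auto simp: exp_neg_ennreal exp_add[symmetric] simp flip: ennreal_plus)

lemma exp_neg_sum: "finite A \<Longrightarrow> exp_neg (sum f A) = (\<Prod>x\<in>A. exp_neg (f x))"
  by (induction A rule: finite_induct) (auto simp: exp_neg_add)

lemma borel_measurable_exp_neg [measurable]: "exp_neg \<in> borel_measurable borel"
  unfolding exp_neg_def[abs_def] by measurable

text \<open>Continuity has to include the point \<open>\<infinity>\<close>, because infinite
  penalties and infinite interference are allowed. There \<open>enn2real\<close> is of no help, and
  antitonicity of \<open>exp_neg\<close> gives the limit 0 directly.\<close>

lemma tendsto_exp_neg:
  assumes "(f \<longlongrightarrow> a) F"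
  shows "((\<lambda>x. exp_neg (f x)) \<longlongrightarrow> exp_neg a) F"
proof (cases a)
  case (real c)
  have "eventually (\<lambda>x. f x < \<infinity>) F"
    using real by (intro order_tendstoD(2)[OF assms]) auto
  then have ev: "eventually (\<lambda>x. exp (- enn2real (f x)) = exp_neg (f x)) F"
    by eventually_elim (auto simp: exp_neg_def)
  have "((\<lambda>x. enn2real (f x)) \<longlongrightarrow> c) F"
    using tendsto_enn2real[of f c F] real assms by auto
  then have "((\<lambda>x. exp (- enn2real (f x))) \<longlongrightarrow> exp (- c)) F"
    by (intro tendsto_exp tendsto_minus)
  then show ?thesis
    using ev real by (auto simp: exp_neg_ennreal dest: Lim_transform_eventually)
next
  case top
  have "((\<lambda>x. exp_neg (f x)) \<longlongrightarrow> 0) F"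
  proof (rule order_tendstoI)
    fix y :: real assume "0 < y"
    \<comment> \<open>The maximum keeps the argument of \<open>exp_neg_ennreal\<close> nonnegative
      when \<open>y > 1\<close>; the threshold \<open>c + 1\<close> instead of \<open>c\<close>
      makes the final inequality strict.\<close>
    define c where "c = max 0 (- ln y)"
    have "exp (- c) \<le> exp (ln y)" by (simp add: c_def)
    also have "\<dots> = y" using \<open>0 < y\<close> by simp
    finally have cy: "exp (- c) \<le> y" .
    have "eventually (\<lambda>x. ennreal (c + 1) < f x) F"
      using top by (intro order_tendstoD(1)[OF assms]) auto
    then show "eventually (\<lambda>x. exp_neg (f x) < y) F"
    proof eventually_elim
      case (elim x)
      have "exp_neg (f x) \<le> exp_neg (ennreal (c + 1))"
        using elim by (intro exp_neg_antimono) auto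
      also have "\<dots> = exp (- (c + 1))" by (rule exp_neg_ennreal) (simp add: c_def)
      also have "\<dots> < exp (- c)" by simp
      finally show ?case using cy by simp
    qed
  next
    fix y :: real assume "y < 0"
    then show "eventually (\<lambda>x. y < exp_neg (f x)) F"
      by (intro always_eventually) (auto intro: less_le_trans)
  qed
  then show ?thesis by (simp add: top)
qed

text \<open>A right inverse of \<open>exp_neg\<close> on the unit interval, with 0 sent to
  \<open>\<infinity>\<close>. It turns a product of deterministic factors, some possibly zero, into
  \<open>exp_neg\<close> of a sum over points, the form that a Laplace functional requires.\<close>

definition neg_ln :: "real \<Rightarrow> ennreal" where
  "neg_ln q = (if q \<le> 0 then \<infinity> else ennreal (- ln q))"

lemma exp_neg_neg_ln: "0 \<le> q \<Longrightarrow> q \<le> 1 \<Longrightarrow> exp_neg (neg_ln q) = q"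
  by (auto simp: neg_ln_def exp_neg_ennreal)

lemma borel_measurable_neg_ln [measurable]: "neg_ln \<in> borel_measurable borel"
  unfolding neg_ln_def[abs_def] by measurable

text \<open>The constant 1 dominates and is integrable on a probability space, so neither
  monotonicity nor finiteness of the variables is needed.\<close>

lemma (in prob_space) tendsto_nn_integral_exp_neg:
  assumes [measurable]: "\<And>n. Y n \<in> borel_measurable M" "Z \<in> borel_measurable M"
    and lim: "AE \<omega> in M. (\<lambda>n::nat. Y n \<omega>) \<longlonglongrightarrow> Z \<omega>"
  shows "(\<lambda>n. \<integral>\<^sup>+\<omega>. exp_neg (Y n \<omega>) \<partial>M) \<longlonglongrightarrow> (\<integral>\<^sup>+\<omega>. exp_neg (Z \<omega>) \<partial>M)"
proof (rule nn_integral_dominated_convergence[where w = "\<lambda>_. 1"])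
  show "AE \<omega> in M. (\<lambda>n. ennreal (exp_neg (Y n \<omega>))) \<longlonglongrightarrow> ennreal (exp_neg (Z \<omega>))"
    using lim by eventually_elim (intro tendsto_ennrealI tendsto_exp_neg)
qed (auto simp: emeasure_space_1)

lemma (in prob_space) nn_integral_exp_neg_suminf:
  assumes [measurable]: "\<And>n. f n \<in> borel_measurable M"
  shows "(\<lambda>N. \<integral>\<^sup>+\<omega>. (\<Prod>n<N. exp_neg (f n \<omega>)) \<partial>M) \<longlonglongrightarrow> (\<integral>\<^sup>+\<omega>. exp_neg (\<Sum>n. f n \<omega>) \<partial>M)"
proof -
  have "(\<lambda>N. \<integral>\<^sup>+\<omega>. exp_neg (\<Sum>n<N. f n \<omega>) \<partial>M) \<longlonglongrightarrow> (\<integral>\<^sup>+\<omega>. exp_neg (\<Sum>n. f n \<omega>) \<partial>M)"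
    by (intro tendsto_nn_integral_exp_neg AE_I2 summable_LIMSEQ) auto
  then show ?thesis by (simp add: exp_neg_sum)
qed

subsection \<open>The Laplace functional of a Poisson point process\<close>

text \<open>The probability generating function of a Poisson variable: splitting by the value of
  \<open>N\<close> leaves the exponential series at \<open>q * \<mu>\<close>.\<close>

lemma (in prob_space) nn_integral_power_Poisson:
  fixes N :: "'a \<Rightarrow> nat"
  assumes [measurable]: "N \<in> measurable M (count_space UNIV)"
    and dist: "\<And>k. prob {\<omega> \<in> space M. N \<omega> = k} = \<mu> ^ k / fact k * exp (- \<mu>)"
    and nonneg: "0 \<le> \<mu>" "0 \<le> q"
  shows "(\<integral>\<^sup>+\<omega>. ennreal q ^ N \<omega> \<partial>M) = exp (- (\<mu> * (1 - q)))"
proof -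
  have "(\<integral>\<^sup>+\<omega>. ennreal q ^ N \<omega> \<partial>M)
      = (\<integral>\<^sup>+\<omega>. (\<Sum>k. ennreal q ^ k * indicator {\<omega> \<in> space M. N \<omega> = k} \<omega>) \<partial>M)"
  proof (intro nn_integral_cong)
    fix \<omega> assume "\<omega> \<in> space M"
    then show "ennreal q ^ N \<omega> = (\<Sum>k. ennreal q ^ k * indicator {\<omega> \<in> space M. N \<omega> = k} \<omega>)"
      by (subst suminf_finite[of "{N \<omega>}"]) auto
  qed
  also have "\<dots> = (\<Sum>k. \<integral>\<^sup>+\<omega>. ennreal q ^ k * indicator {\<omega> \<in> space M. N \<omega> = k} \<omega> \<partial>M)"
    by (intro nn_integral_suminf) measurable
  also have "\<dots> = (\<Sum>k. ennreal ((q * \<mu>) ^ k /\<^sub>R fact k * exp (- \<mu>)))"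
    using nonneg
    by (intro suminf_cong, subst nn_integral_cmult_indicator)
       (auto simp: emeasure_eq_measure dist ennreal_power power_mult_distrib divide_simps
             simp flip: ennreal_mult)
  also have "\<dots> = ennreal (exp (q * \<mu>) * exp (- \<mu>))"
    using nonneg by (intro suminf_ennreal_eq sums_mult2 exp_converges) auto
  also have "exp (q * \<mu>) * exp (- \<mu>) = exp (- (\<mu> * (1 - q)))"
    by (simp add: exp_add[symmetric] algebra_simps)
  finally show ?thesis .
qed

text \<open>For \<open>\<phi>\<close> with finitely many values, the sum over the points is determined by the numbers
  of points in the level sets, which are independent Poisson variables.\<close>

lemma (in prob_space) Laplace_functional_PPP_simple:
  fixes X :: "nat \<Rightarrow> 'a \<Rightarrow> real ^ 2" and \<phi> :: "real ^ 2 \<Rightarrow> ennreal"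
  assumes ppp: "homogeneous_PPP M d X" and d: "0 \<le> d"
    and [measurable]: "\<phi> \<in> borel_measurable borel"
    and fin: "finite (range \<phi>)" and bdd: "bounded {x. \<phi> x \<noteq> 0}"
  shows "(\<integral>\<^sup>+\<omega>. exp_neg (\<Sum>n. \<phi> (X n \<omega>)) \<partial>M)
       = exp_neg (ennreal d * (\<integral>\<^sup>+x. ennreal (1 - exp_neg (\<phi> x)) \<partial>lborel))"
proof -
  \<comment> \<open>The level set of 0 is unbounded, so its points cannot be counted; they
    contribute nothing to the sum. All other level sets are bounded.\<close>
  define K where "K = range \<phi> - {0}"
  define B where "B a = \<phi> -` {a}" for a
  have [measurable]: "B a \<in> sets borel" for a
    using measurable_sets[of \<phi> borel borel "{a}"] by (simp add: B_def)
  have finK: "finite K" using fin by (simp add: K_def)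
  have bddB: "bounded (B a)" if "a \<in> K" for a
    using that by (intro bounded_subset[OF bdd]) (auto simp: K_def B_def)
  have disj: "disjoint_family_on B K"
    by (auto simp: disjoint_family_on_def B_def)
  have locfin: "AE \<omega> in M. \<forall>B. bounded B \<longrightarrow> finite {n. X n \<omega> \<in> B}"
    using ppp by (auto simp: homogeneous_PPP_def)
  have count: "prob {\<omega> \<in> space M. point_count X (B a) \<omega> = k}
      = (d * measure lborel (B a)) ^ k / fact k * exp (- (d * measure lborel (B a)))"
    if "a \<in> K" for a k
    using ppp bddB[OF that] by (auto simp: homogeneous_PPP_def)
  have indep: "indep_vars (\<lambda>_. count_space UNIV) (\<lambda>k. point_count X (C k)) I"
    if "finite I" "disjoint_family_on C I" "\<And>k. k \<in> I \<Longrightarrow> C k \<in> sets borel \<and> bounded (C k)"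
    for I :: "nat set" and C
    using ppp that unfolding homogeneous_PPP_def by blast
  \<comment> \<open>Independence of a family includes measurability of its members, so a family with
    one member suffices.\<close>
  have meas: "point_count X (B a) \<in> measurable M (count_space UNIV)" if "a \<in> K" for a
    using indep[of "{0}" "\<lambda>_. B a"] bddB[OF that]
    by (auto simp: indep_vars_def disjoint_family_on_def)
  \<comment> \<open>\<open>homogeneous_PPP\<close> gives independence for families indexed by \<open>nat\<close> only.\<close>
  obtain h :: "nat \<Rightarrow> ennreal" where h: "bij_betw h {..<card K} K"
    using finK ex_bij_betw_nat_finite[of K] by (auto simp: atLeast0LessThan)
  have indepB: "indep_vars (\<lambda>_. count_space UNIV) (\<lambda>k. point_count X (B (h k))) {..<card K}"
  proof (rule indep)
    show "disjoint_family_on (\<lambda>k. B (h k)) {..<card K}"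
      using h by (auto simp: disjoint_family_on_def B_def bij_betw_def inj_on_def)
    show "B (h k) \<in> sets borel \<and> bounded (B (h k))" if "k \<in> {..<card K}" for k
      using that h by (intro conjI bddB) (auto simp: bij_betw_def)
  qed simp
  have decomp: "(\<Sum>n. \<phi> (X n \<omega>)) = (\<Sum>a\<in>K. of_nat (point_count X (B a) \<omega>) * a)"
    if fin\<omega>: "\<forall>B. bounded B \<longrightarrow> finite {n. X n \<omega> \<in> B}" for \<omega>
  proof -
    have "\<phi> x = (\<Sum>a\<in>K. a * indicator (B a) x)" for x
    proof -
      have "(\<Sum>a\<in>K. a * indicator (B a) x) = (\<Sum>a\<in>K. if a = \<phi> x then a else 0)"
        by (intro sum.cong) (auto simp: B_def indicator_def)
      also have "\<dots> = \<phi> x" using finK by (auto simp: K_def)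
      finally show ?thesis ..
    qed
    then have "(\<Sum>n. \<phi> (X n \<omega>)) = (\<Sum>n. \<Sum>a\<in>K. a * indicator (B a) (X n \<omega>))"
      by simp
    also have "\<dots> = (\<Sum>a\<in>K. \<Sum>n. a * indicator (B a) (X n \<omega>))"
      by (intro suminf_sum) auto
    also have "\<dots> = (\<Sum>a\<in>K. of_nat (point_count X (B a) \<omega>) * a)"
    proof (intro sum.cong refl)
      fix a assume "a \<in> K"
      then have "finite {n. X n \<omega> \<in> B a}" using fin\<omega> bddB by auto
      then have "(\<Sum>n. a * indicator (B a) (X n \<omega>)) = (\<Sum>n\<in>{n. X n \<omega> \<in> B a}. a * indicator (B a) (X n \<omega>))"
        by (intro suminf_finite) auto
      also have "\<dots> = of_nat (point_count X (B a) \<omega>) * a"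
        by (simp add: point_count_def)
      finally show "(\<Sum>n. a * indicator (B a) (X n \<omega>)) = of_nat (point_count X (B a) \<omega>) * a" .
    qed
    finally show ?thesis .
  qed
  \<comment> \<open>The level \<open>a = \<infinity>\<close> is covered too: for
    \<open>k = 0\<close> both sides are 1, since \<open>0 * \<infinity> = 0\<close> and
    \<open>0 ^ 0 = 1\<close>.\<close>
  have exp_mult: "exp_neg (of_nat k * a) = exp_neg a ^ k" for k a
    by (induction k) (auto simp: algebra_simps exp_neg_add)
  have "(\<integral>\<^sup>+\<omega>. exp_neg (\<Sum>n. \<phi> (X n \<omega>)) \<partial>M)
      = (\<integral>\<^sup>+\<omega>. (\<Prod>a\<in>K. ennreal (exp_neg a) ^ point_count X (B a) \<omega>) \<partial>M)"
    using locfin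
    by (intro nn_integral_cong_AE)
       (auto elim!: eventually_mono simp: decomp exp_neg_sum[OF finK] exp_mult ennreal_power prod_ennreal)
  also have "\<dots> = (\<Prod>a\<in>K. \<integral>\<^sup>+\<omega>. ennreal (exp_neg a) ^ point_count X (B a) \<omega> \<partial>M)"
    by (subst (1 2) prod.reindex_bij_betw[OF h, symmetric])
       (intro indep_vars_nn_integral indep_vars_compose2[OF indepB]; simp)
  also have "\<dots> = (\<Prod>a\<in>K. ennreal (exp (- (d * measure lborel (B a) * (1 - exp_neg a)))))"
    using d by (intro prod.cong refl nn_integral_power_Poisson count meas) auto
  also have "\<dots> = exp_neg (\<Sum>a\<in>K. ennreal (d * measure lborel (B a) * (1 - exp_neg a)))"
    using d finK by (simp add: prod_ennreal exp_neg_sum exp_neg_ennreal del: sum_ennreal)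
  also have "(\<Sum>a\<in>K. ennreal (d * measure lborel (B a) * (1 - exp_neg a)))
      = ennreal d * (\<Sum>a\<in>K. ennreal (1 - exp_neg a) * emeasure lborel (B a))"
    unfolding sum_distrib_left
  proof (intro sum.cong refl)
    fix a assume "a \<in> K"
    then have "emeasure lborel (B a) = ennreal (measure lborel (B a))"
      using emeasure_bounded_finite[OF bddB, of a]
      by (intro emeasure_eq_ennreal_measure) auto
    then show "ennreal (d * measure lborel (B a) * (1 - exp_neg a))
        = ennreal d * (ennreal (1 - exp_neg a) * emeasure lborel (B a))"
      using d by (simp add: ennreal_mult mult_ac)
  qed
  also have "(\<Sum>a\<in>K. ennreal (1 - exp_neg a) * emeasure lborel (B a))
      = (\<integral>\<^sup>+x. (\<Sum>a\<in>K. ennreal (1 - exp_neg a) * indicator (B a) x) \<partial>lborel)"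
    by (subst nn_integral_sum) (auto simp: nn_integral_cmult_indicator)
  also have "\<dots> = (\<integral>\<^sup>+x. ennreal (1 - exp_neg (\<phi> x)) \<partial>lborel)"
  proof (intro nn_integral_cong)
    fix x
    have "(\<Sum>a\<in>K. ennreal (1 - exp_neg a) * indicator (B a) x)
        = (\<Sum>a\<in>K. if a = \<phi> x then ennreal (1 - exp_neg a) else 0)"
      by (intro sum.cong) (auto simp: B_def indicator_def)
    also have "\<dots> = ennreal (1 - exp_neg (\<phi> x))" using finK by (auto simp: K_def)
    finally show "(\<Sum>a\<in>K. ennreal (1 - exp_neg a) * indicator (B a) x) = ennreal (1 - exp_neg (\<phi> x))" .
  qed
  finally show ?thesis .
qed

text \<open>Both sides pass to the limit along simple functions increasing to \<open>\<phi>\<close>: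
  the sums and the integral on the right by monotone convergence, the expectation on the left by
  domination.\<close>

lemma (in prob_space) Laplace_functional_PPP:
  fixes X :: "nat \<Rightarrow> 'a \<Rightarrow> real ^ 2" and \<phi> :: "real ^ 2 \<Rightarrow> ennreal"
  assumes ppp: "homogeneous_PPP M d X" and d: "0 \<le> d"
    and [measurable]: "\<phi> \<in> borel_measurable borel"
  shows "(\<integral>\<^sup>+\<omega>. exp_neg (\<Sum>n. \<phi> (X n \<omega>)) \<partial>M)
       = exp_neg (ennreal d * (\<integral>\<^sup>+x. ennreal (1 - exp_neg (\<phi> x)) \<partial>lborel))"
proof -
  obtain f where f: "\<And>k. simple_function borel (f k)" "incseq f" "\<And>x. (SUP k. f k x) = \<phi> x"
    using borel_measurable_implies_simple_function_sequence'[of \<phi> borel] assms(3) by metis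
  have [measurable]: "f k \<in> borel_measurable borel" for k
    using f(1) by (rule borel_measurable_simple_function)
  have [measurable]: "X n \<in> borel_measurable M" for n
    using ppp by (auto simp: homogeneous_PPP_def)
  \<comment> \<open>Cutting off to growing balls provides the bounded support demanded by the simple
    case, and keeps the sequence increasing.\<close>
  define g where "g k x = f k x * indicator (ball 0 (real k)) x" for k x
  have [measurable]: "g k \<in> borel_measurable borel" for k
    unfolding g_def[abs_def]
    by (intro borel_measurable_times_ennreal borel_measurable_indicator) auto
  have inc: "incseq (\<lambda>k. g k x)" for x
    unfolding g_def using incseqD[OF f(2)]
    by (auto simp: incseq_def indicator_def le_fun_def split: if_splits)
  have lim: "(\<lambda>k. g k x) \<longlonglongrightarrow> \<phi> x" for x
  proof -
    obtain k0 :: nat where "norm x < real k0" using reals_Archimedean2 by blast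
    then have ev: "eventually (\<lambda>k. f k x = g k x) sequentially"
      by (intro eventually_sequentiallyI[of k0]) (auto simp: g_def)
    have "(\<lambda>k. f k x) \<longlonglongrightarrow> (SUP k. f k x)"
      using f(2) by (intro LIMSEQ_SUP) (auto simp: incseq_def le_fun_def)
    then show ?thesis
      using ev by (auto simp: f(3) dest: Lim_transform_eventually)
  qed
  have supg: "(SUP k. g k x) = \<phi> x" for x
    using LIMSEQ_unique[OF LIMSEQ_SUP[OF inc] lim] .
  have simple: "(\<integral>\<^sup>+\<omega>. exp_neg (\<Sum>n. g k (X n \<omega>)) \<partial>M)
      = exp_neg (ennreal d * (\<integral>\<^sup>+x. ennreal (1 - exp_neg (g k x)) \<partial>lborel))" for k
  proof (intro Laplace_functional_PPP_simple[OF ppp d])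
    have "finite (range (f k))" using f(1)[of k] by (simp add: simple_function_def)
    moreover have "range (g k) \<subseteq> insert 0 (range (f k))"
      by (auto simp: g_def indicator_def)
    ultimately show "finite (range (g k))" by (meson finite.insertI finite_subset)
    show "bounded {x. g k x \<noteq> 0}"
      by (rule bounded_subset[OF bounded_ball[of 0 "real k"]]) (auto simp: g_def indicator_def)
  qed auto
  have "(\<lambda>k. \<integral>\<^sup>+\<omega>. exp_neg (\<Sum>n. g k (X n \<omega>)) \<partial>M) \<longlonglongrightarrow> (\<integral>\<^sup>+\<omega>. exp_neg (\<Sum>n. \<phi> (X n \<omega>)) \<partial>M)"
  proof (intro tendsto_nn_integral_exp_neg AE_I2)
    fix \<omega>
    have "(\<lambda>k. \<integral>\<^sup>+n. g k (X n \<omega>) \<partial>count_space UNIV) \<longlonglongrightarrow> (\<integral>\<^sup>+n. \<phi> (X n \<omega>) \<partial>count_space UNIV)"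
      using inc lim by (intro nn_integral_LIMSEQ) (auto simp: incseq_def le_fun_def)
    then show "(\<lambda>k. \<Sum>n. g k (X n \<omega>)) \<longlonglongrightarrow> (\<Sum>n. \<phi> (X n \<omega>))"
      by (simp add: nn_integral_count_space_nat)
  qed measurable
  moreover have "(\<lambda>k. exp_neg (ennreal d * (\<integral>\<^sup>+x. ennreal (1 - exp_neg (g k x)) \<partial>lborel)))
      \<longlonglongrightarrow> exp_neg (ennreal d * (\<integral>\<^sup>+x. ennreal (1 - exp_neg (\<phi> x)) \<partial>lborel))"
  proof (intro tendsto_exp_neg ennreal_tendsto_cmult nn_integral_LIMSEQ)
    show "incseq (\<lambda>k x. ennreal (1 - exp_neg (g k x)))"
      using inc by (auto simp: incseq_def le_fun_def intro!: ennreal_leI exp_neg_antimono)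
    show "(\<lambda>k. ennreal (1 - exp_neg (g k x))) \<longlonglongrightarrow> ennreal (1 - exp_neg (\<phi> x))" for x
      by (intro tendsto_ennrealI tendsto_diff tendsto_const tendsto_exp_neg lim)
  qed auto
  ultimately show ?thesis
    unfolding simple by (rule LIMSEQ_unique[OF _ tendsto_ennrealI])
qed

subsection \<open>Polar coordinates\<close>

lemma UN_atMost_real_nat: "(\<Union>k::nat. {..real k}) = UNIV"
  using real_arch_simple by auto

text \<open>Half-lines generate the Borel sets and are stable under intersection, so it is enough
  that the disc of radius \<open>a\<close> has area \<open>pi * a\<^sup>2\<close>, the integral of
  \<open>2 * pi * x\<close> up to \<open>a\<close>.\<close>

lemma distr_norm_lborel_plane:
  "distr lborel borel (norm :: real ^ 2 \<Rightarrow> real)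
     = density lborel (\<lambda>x. ennreal (2 * pi * x) * indicator {0..} x)"
    (is "?D = ?E")
proof (rule measure_eqI_generator_eq[where E = "range atMost" and \<Omega> = UNIV and A = "\<lambda>k::nat. {..real k}"])
  have D: "emeasure ?D {..a} = (if 0 \<le> a then ennreal (pi * a\<^sup>2) else 0)" for a
  proof -
    have "emeasure ?D {..a} = emeasure lborel (cball (0 :: real ^ 2) a)"
      by (subst emeasure_distr) (auto simp: cball_def dist_norm vimage_def)
    then show ?thesis
      by (auto simp: emeasure_cball unit_ball_vol_2 cball_eq_empty)
  qed
  have E: "emeasure ?E {..a} = (if 0 \<le> a then ennreal (pi * a\<^sup>2) else 0)" for a
  proof (cases "0 \<le> a")
    case True
    have "emeasure ?E {..a} = (\<integral>\<^sup>+x. ennreal (2 * pi * x) * indicator {0..a} x \<partial>lborel)"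
      by (subst emeasure_density) (auto intro!: nn_integral_cong simp: indicator_def)
    also have "\<dots> = ennreal (pi * a\<^sup>2 - pi * 0\<^sup>2)"
      using True
      by (intro nn_integral_FTC_Icc[where F = "\<lambda>x. pi * x\<^sup>2"])
         (auto intro!: derivative_eq_intros)
    finally show ?thesis using True by simp
  next
    case False
    have "emeasure ?E {..a} = (\<integral>\<^sup>+x. ennreal (2 * pi * x) * indicator {0..} x * indicator {..a} x \<partial>lborel)"
      by (subst emeasure_density) auto
    also have "\<dots> = (\<integral>\<^sup>+(x::real). 0 \<partial>lborel)"
      using False by (intro nn_integral_cong) (auto simp: indicator_def)
    finally show ?thesis using False by simp
  qed
  show "emeasure ?D A = emeasure ?E A" if "A \<in> range atMost" for A
    using that by (auto simp: D E)
  show "emeasure ?D {..real k} \<noteq> \<infinity>" for k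
    by (auto simp: D)
  show "Int_stable (range (atMost :: real \<Rightarrow> real set))"
    by (auto simp: Int_stable_def)
qed (auto simp: borel_eq_atMost UN_atMost_real_nat)

lemma nn_integral_norm_plane:
  assumes [measurable]: "h \<in> borel_measurable borel"
  shows "(\<integral>\<^sup>+x. h (norm (x :: real ^ 2)) \<partial>lborel)
       = ennreal (2 * pi) * (\<integral>\<^sup>+y\<in>{0..}. h y * ennreal y \<partial>lborel)"
proof -
  have "(\<integral>\<^sup>+x. h (norm (x :: real ^ 2)) \<partial>lborel) = (\<integral>\<^sup>+y. h y \<partial>distr lborel borel (norm :: real ^ 2 \<Rightarrow> real))"
    by (subst nn_integral_distr) auto
  also have "\<dots> = (\<integral>\<^sup>+y. ennreal (2 * pi) * (h y * ennreal y * indicator {0..} y) \<partial>lborel)"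
    unfolding distr_norm_lborel_plane
    by (subst nn_integral_density)
       (auto intro!: nn_integral_cong simp: indicator_def ennreal_mult algebra_simps)
  also have "\<dots> = ennreal (2 * pi) * (\<integral>\<^sup>+y\<in>{0..}. h y * ennreal y \<partial>lborel)"
    by (intro nn_integral_cmult) measurable
  finally show ?thesis .
qed

subsection \<open>Gamma densities\<close>

lemma borel_measurable_gamma_density [measurable]: "gamma_density k \<beta> \<in> borel_measurable borel"
  unfolding gamma_density_def[abs_def] by measurable

text \<open>For rate 1 this is Euler's integral for \<open>Gamma k\<close>; a general rate follows
  by the substitution that scales the variable by \<open>\<beta>\<close>.\<close>

lemma nn_integral_gamma_density:
  assumes k: "0 < k" and b: "0 < \<beta>"
  shows "(\<integral>\<^sup>+x. ennreal (gamma_density k \<beta> x) \<partial>lborel) = 1"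
proof -
  have "((\<lambda>t. t powr (k - 1) / exp t) has_integral Gamma k) {0..}"
    by (rule Gamma_integral_real[OF k])
  then have "(\<integral>\<^sup>+t\<in>{0..}. ennreal (t powr (k - 1) / exp t) \<partial>lborel) = ennreal (Gamma k)"
    by (intro nn_integral_has_integral_lebesgue') auto
  then have "1 = (\<integral>\<^sup>+t\<in>{0..}. ennreal (t powr (k - 1) / exp t) \<partial>lborel) / ennreal (Gamma k)"
    using Gamma_real_pos[OF k] by (simp add: divide_ennreal)
  also have "\<dots> = (\<integral>\<^sup>+t\<in>{0..}. ennreal (t powr (k - 1) / exp t) / ennreal (Gamma k) \<partial>lborel)"
    by (subst nn_integral_divide[symmetric]) (auto simp: ennreal_times_divide mult.commute)
  also have "\<dots> = (\<integral>\<^sup>+t. ennreal (gamma_density k 1 t) \<partial>lborel)"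
  proof (intro nn_integral_cong)
    fix t :: real
    show "ennreal (t powr (k - 1) / exp t) / ennreal (Gamma k) * indicator {0..} t
        = ennreal (gamma_density k 1 t)"
    proof (cases "t > 0")
      case True
      then show ?thesis
        using Gamma_real_pos[OF k] by (simp add: gamma_density_def divide_ennreal exp_minus divide_inverse)
    next
      case False
      \<comment> \<open>At \<open>t = 0\<close> the two integrands agree because
        \<open>0 powr (k - 1) = 0\<close> for every \<open>k\<close>.\<close>
      then show ?thesis by (cases "t = 0") (simp_all add: gamma_density_def)
    qed
  qed
  also have "\<dots> = ennreal \<beta> * (\<integral>\<^sup>+t. ennreal (gamma_density k 1 (0 + \<beta> * t)) \<partial>lborel)"
    using b by (subst nn_integral_real_affine[where c = \<beta> and t = 0]) auto
  also have "\<dots> = (\<integral>\<^sup>+t. ennreal \<beta> * ennreal (gamma_density k 1 (0 + \<beta> * t)) \<partial>lborel)"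
    by (rule nn_integral_cmult[symmetric]) auto
  also have "\<dots> = (\<integral>\<^sup>+t. ennreal (gamma_density k \<beta> t) \<partial>lborel)"
  proof (intro nn_integral_cong)
    fix t
    have "gamma_density k \<beta> t = \<beta> * gamma_density k 1 (0 + \<beta> * t)"
      using b by (simp add: gamma_density_def powr_mult powr_diff mult_le_0_iff)
    then show "ennreal \<beta> * ennreal (gamma_density k 1 (0 + \<beta> * t)) = ennreal (gamma_density k \<beta> t)"
      using b by (simp add: ennreal_mult')
  qed
  finally show ?thesis ..
qed

text \<open>Tilting a Gamma density by \<open>exp (- t x)\<close> only changes its rate, up to normalisation.\<close>

lemma nn_integral_exp_gamma_density:
  assumes k: "0 < k" and b: "0 < \<beta>" and t: "0 \<le> t"
  shows "(\<integral>\<^sup>+x. ennreal (gamma_density k \<beta> x) * ennreal (exp (- (t * x))) \<partial>lborel)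
       = ennreal ((\<beta> / (\<beta> + t)) powr k)"
proof -
  have "(\<integral>\<^sup>+x. ennreal (gamma_density k \<beta> x) * ennreal (exp (- (t * x))) \<partial>lborel)
      = (\<integral>\<^sup>+x. ennreal ((\<beta> / (\<beta> + t)) powr k) * ennreal (gamma_density k (\<beta> + t) x) \<partial>lborel)"
  proof (intro nn_integral_cong)
    fix x
    have e: "exp (- \<beta> * x) * exp (- (t * x)) = exp (- (\<beta> + t) * x)"
      by (simp add: exp_add[symmetric] algebra_simps)
    have p: "\<beta> powr k = (\<beta> / (\<beta> + t)) powr k * (\<beta> + t) powr k"
      using b t by (simp add: powr_divide)
    have "(\<beta> powr k * x powr (k - 1) * exp (- \<beta> * x) / Gamma k) * exp (- (t * x))
        = \<beta> powr k * x powr (k - 1) * (exp (- \<beta> * x) * exp (- (t * x))) / Gamma k"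
      by (simp only: times_divide_eq_left mult.assoc)
    also have "\<dots> = (\<beta> / (\<beta> + t)) powr k * ((\<beta> + t) powr k * x powr (k - 1) * exp (- (\<beta> + t) * x) / Gamma k)"
      unfolding e p by (simp only: times_divide_eq_right mult.assoc)
    finally have "(\<beta> powr k * x powr (k - 1) * exp (- \<beta> * x) / Gamma k) * exp (- (t * x))
        = (\<beta> / (\<beta> + t)) powr k * ((\<beta> + t) powr k * x powr (k - 1) * exp (- (\<beta> + t) * x) / Gamma k)" .
    then have *: "gamma_density k \<beta> x * exp (- (t * x)) = (\<beta> / (\<beta> + t)) powr k * gamma_density k (\<beta> + t) x"
      by (cases "x \<le> 0") (simp_all only: gamma_density_def if_True if_False mult_zero_left mult_zero_right)
    show "ennreal (gamma_density k \<beta> x) * ennreal (exp (- (t * x)))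
        = ennreal ((\<beta> / (\<beta> + t)) powr k) * ennreal (gamma_density k (\<beta> + t) x)"
      unfolding ennreal_mult''[OF exp_ge_zero, symmetric] ennreal_mult'[OF powr_ge_zero, symmetric] * ..
  qed
  also have "\<dots> = ennreal ((\<beta> / (\<beta> + t)) powr k)"
    using assms by (subst nn_integral_cmult) (simp_all add: nn_integral_gamma_density)
  finally show ?thesis .
qed

subsection \<open>Independent groups of sources\<close>

context uav_network
begin

text \<open>Only the measurable sets matter here, not the measure. A function measurable for this
  structure is one that depends on the sources in \<open>A\<close> alone.\<close>

definition sub_algebra :: "source set \<Rightarrow> 'w measure" where
  "sub_algebra A = sigma (space M) (\<Union>k\<in>A. source_sets M X U G k)"

lemma position_measurable [measurable]: "X t n \<in> borel_measurable M"
  using positions[of t] by (auto simp: homogeneous_PPP_def)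

lemma blockage_measurable [measurable]: "U t n \<in> borel_measurable M"
  using blockage[of t n] by (auto simp: distributed_def)

lemma fading_measurable [measurable]: "G j v \<in> borel_measurable M"
  using fading[of j v] by (auto simp: distributed_def)

lemma source_sets_subset: "source_sets M X U G k \<subseteq> sets M"
  using indep_sources by (auto simp: indep_sets_def)

lemma space_sub_algebra [simp]: "space (sub_algebra A) = space M"
  by (simp add: sub_algebra_def space_measure_of_conv)

lemma sets_sub_algebra: "sets (sub_algebra A) = sigma_sets (space M) (\<Union>k\<in>A. source_sets M X U G k)"
  unfolding sub_algebra_def
  using source_sets_subset sets.space_closed by (intro sets_measure_of) blast

text \<open>Pushing \<open>M\<close> forward along this identity map restricts it to the coarser
  sigma-algebra.\<close>

lemma measurable_id_sub_algebra: "(\<lambda>\<omega>. \<omega>) \<in> measurable M (sub_algebra A)"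
proof (rule measurableI)
  fix B assume B: "B \<in> sets (sub_algebra A)"
  have "sets (sub_algebra A) \<subseteq> sets M"
    unfolding sets_sub_algebra using source_sets_subset by (intro sets.sigma_sets_subset) blast
  with B show "(\<lambda>\<omega>. \<omega>) -` B \<inter> space M \<in> sets M"
    using sets.sets_into_space by (auto simp: Int_absorb2)
qed simp

lemma measurable_from_sub_algebra: "f \<in> measurable (sub_algebra A) N \<Longrightarrow> f \<in> measurable M N"
  using measurable_compose[OF measurable_id_sub_algebra] by blast

lemma source_sets_sub_algebra: "k \<in> A \<Longrightarrow> source_sets M X U G k \<subseteq> sets (sub_algebra A)"
  by (auto simp: sets_sub_algebra)

lemma measurable_sub_algebraI:
  assumes "f \<in> measurable N L" "sets N \<subseteq> sets (sub_algebra A)" "space N = space M"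
  shows "f \<in> measurable (sub_algebra A) L"
  using assms by (auto simp: measurable_def)

lemma position_measurable_sub:
  assumes "Position t \<in> A"
  shows "X t n \<in> borel_measurable (sub_algebra A)"
proof (rule measurable_sub_algebraI)
  have "(\<lambda>\<omega>. (\<lambda>n. X t n \<omega>) n) \<in> borel_measurable (vimage_algebra (space M) (\<lambda>\<omega> n. X t n \<omega>) (\<Pi>\<^sub>M n\<in>UNIV. borel))"
    by (rule measurable_compose[OF measurable_vimage_algebra1 measurable_component_singleton])
       (auto simp: space_PiM)
  then show "X t n \<in> borel_measurable (vimage_algebra (space M) (\<lambda>\<omega> n. X t n \<omega>) (\<Pi>\<^sub>M n\<in>UNIV. borel))"
    by simp
qed (use source_sets_sub_algebra[OF assms] in auto)

lemma blockage_measurable_sub: "Blockage t n \<in> A \<Longrightarrow> U t n \<in> borel_measurable (sub_algebra A)"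
  using source_sets_sub_algebra[of "Blockage t n" A]
  by (intro measurable_sub_algebraI[OF measurable_vimage_algebra1]) auto

lemma fading_measurable_sub: "Fading j v \<in> A \<Longrightarrow> G j v \<in> borel_measurable (sub_algebra A)"
  using source_sets_sub_algebra[of "Fading j v" A]
  by (intro measurable_sub_algebraI[OF measurable_vimage_algebra1]) auto

lemma indep_sub_algebra:
  assumes disj: "A \<inter> B = {}" and a: "a \<in> sets (sub_algebra A)" and b: "b \<in> sets (sub_algebra B)"
  shows "prob (a \<inter> b) = prob a * prob b"
proof -
  \<comment> \<open>Booleans index the two groups. Each source family is already a sigma-algebra,
    hence stable under intersection, so independence passes to the generated sigma-algebras.\<close>
  have "indep_sets (\<lambda>c. sigma_sets (space M) (\<Union>k\<in>(if c then A else B). source_sets M X U G k)) UNIV"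
  proof (rule indep_sets_collect_sigma[where I = "\<lambda>c. if c then A else B"])
    show "indep_sets (source_sets M X U G) (\<Union>c\<in>UNIV. if c then A else B)"
      by (rule indep_sets_mono_index[OF _ indep_sources]) simp
    show "Int_stable (source_sets M X U G k)" for k
      by (cases k) (auto simp: Int_stable_def)
  qed (use disj in \<open>auto simp: disjoint_family_on_def\<close>)
  then have "indep_sets (\<lambda>c. sets (sub_algebra (if c then A else B))) UNIV"
    by (simp add: sets_sub_algebra)
  then have "prob (\<Inter>c\<in>UNIV. if c then a else b) = (\<Prod>c\<in>UNIV. prob (if c then a else b))"
    using a b by (intro indep_setsD) auto
  then show ?thesis
    by (simp add: UNIV_bool Int_commute mult.commute)
qed

text \<open>Disjoint groups of sources can be resampled independently of each other.\<close>

lemma nn_integral_decouple: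
  assumes disj: "A \<inter> B = {}"
    and F: "F \<in> borel_measurable (sub_algebra A \<Otimes>\<^sub>M sub_algebra B)"
  shows "(\<integral>\<^sup>+\<omega>. F (\<omega>, \<omega>) \<partial>M) = (\<integral>\<^sup>+\<omega>. \<integral>\<^sup>+\<omega>'. F (\<omega>, \<omega>') \<partial>M \<partial>M)"
proof -
  note [measurable] = measurable_id_sub_algebra
  define DA where "DA = distr M (sub_algebra A) (\<lambda>\<omega>. \<omega>)"
  define DB where "DB = distr M (sub_algebra B) (\<lambda>\<omega>. \<omega>)"
  interpret DA: prob_space DA unfolding DA_def by (rule prob_space_distr) measurable
  interpret DB: prob_space DB unfolding DB_def by (rule prob_space_distr) measurable
  have setsD: "sets DA = sets (sub_algebra A)" "sets DB = sets (sub_algebra B)"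
    by (simp_all add: DA_def DB_def)
  \<comment> \<open>Independence of the two groups says exactly that the law of the diagonal map is
    the product of the restrictions of \<open>M\<close>; it is checked on rectangles.\<close>
  have pair: "DA \<Otimes>\<^sub>M DB = distr M (sub_algebra A \<Otimes>\<^sub>M sub_algebra B) (\<lambda>\<omega>. (\<omega>, \<omega>))"
  proof (rule pair_measure_eqI)
    show "sets (DA \<Otimes>\<^sub>M DB) = sets (distr M (sub_algebra A \<Otimes>\<^sub>M sub_algebra B) (\<lambda>\<omega>. (\<omega>, \<omega>)))"
      using sets_pair_measure_cong[OF setsD] by simp
    fix a b assume "a \<in> sets DA" "b \<in> sets DB"
    then have ab: "a \<in> sets (sub_algebra A)" "b \<in> sets (sub_algebra B)"
      by (simp_all add: setsD)
    then have sub: "a \<subseteq> space M" "b \<subseteq> space M"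
      using sets.sets_into_space by fastforce+
    have "emeasure (distr M (sub_algebra A \<Otimes>\<^sub>M sub_algebra B) (\<lambda>\<omega>. (\<omega>, \<omega>))) (a \<times> b) = emeasure M (a \<inter> b)"
      using ab sub by (subst emeasure_distr) (auto intro!: arg_cong[where f = "emeasure M"])
    moreover have "emeasure DA a = emeasure M a"
      unfolding DA_def using ab sub by (subst emeasure_distr) (auto intro!: arg_cong[where f = "emeasure M"])
    moreover have "emeasure DB b = emeasure M b"
      unfolding DB_def using ab sub by (subst emeasure_distr) (auto intro!: arg_cong[where f = "emeasure M"])
    ultimately show "emeasure DA a * emeasure DB b
        = emeasure (distr M (sub_algebra A \<Otimes>\<^sub>M sub_algebra B) (\<lambda>\<omega>. (\<omega>, \<omega>))) (a \<times> b)"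
      by (simp add: emeasure_eq_measure indep_sub_algebra[OF disj ab] ennreal_mult)
  qed unfold_locales
  have F': "F \<in> borel_measurable (DA \<Otimes>\<^sub>M DB)"
    using F by (simp add: pair)
  have "(\<integral>\<^sup>+\<omega>. F (\<omega>, \<omega>) \<partial>M) = (\<integral>\<^sup>+p. F p \<partial>(DA \<Otimes>\<^sub>M DB))"
    unfolding pair using F by (subst nn_integral_distr) auto
  also have "\<dots> = (\<integral>\<^sup>+\<omega>. \<integral>\<^sup>+\<omega>'. F (\<omega>, \<omega>') \<partial>DB \<partial>DA)"
    using DB.nn_integral_fst[OF F'] by simp
  also have "\<dots> = (\<integral>\<^sup>+\<omega>. \<integral>\<^sup>+\<omega>'. F (\<omega>, \<omega>') \<partial>DB \<partial>M)"
    unfolding DA_def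
  proof (rule nn_integral_distr)
    show "(\<lambda>\<omega>. \<integral>\<^sup>+\<omega>'. F (\<omega>, \<omega>') \<partial>DB) \<in> borel_measurable (distr M (sub_algebra A) (\<lambda>\<omega>. \<omega>))"
      using DB.borel_measurable_nn_integral_fst[OF F'] by (simp add: DA_def)
  qed measurable
  also have "\<dots> = (\<integral>\<^sup>+\<omega>. \<integral>\<^sup>+\<omega>'. F (\<omega>, \<omega>') \<partial>M \<partial>M)"
  proof (intro nn_integral_cong)
    fix \<omega> assume "\<omega> \<in> space M"
    then have "(\<lambda>\<omega>'. F (\<omega>, \<omega>')) \<in> borel_measurable (sub_algebra B)"
      using measurable_Pair2[OF F, of \<omega>] by simp
    then show "(\<integral>\<^sup>+\<omega>'. F (\<omega>, \<omega>') \<partial>DB) = (\<integral>\<^sup>+\<omega>'. F (\<omega>, \<omega>') \<partial>M)"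
      unfolding DB_def by (intro nn_integral_distr) auto
  qed
  finally show ?thesis .
qed

lemma nn_integral_mult_indep:
  assumes disj: "A \<inter> B = {}"
    and [measurable]: "f \<in> borel_measurable (sub_algebra A)" "g \<in> borel_measurable (sub_algebra B)"
  shows "(\<integral>\<^sup>+\<omega>. f \<omega> * g \<omega> \<partial>M) = (\<integral>\<^sup>+\<omega>. f \<omega> \<partial>M) * (\<integral>\<^sup>+\<omega>. g \<omega> \<partial>M)"
proof -
  have [measurable]: "f \<in> borel_measurable M" "g \<in> borel_measurable M"
    using assms(2,3) measurable_from_sub_algebra by blast+
  have "(\<integral>\<^sup>+\<omega>. f \<omega> * g \<omega> \<partial>M) = (\<integral>\<^sup>+\<omega>. \<integral>\<^sup>+\<omega>'. f \<omega> * g \<omega>' \<partial>M \<partial>M)"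
    using nn_integral_decouple[OF disj, of "\<lambda>(x, y). f x * g y"] by simp
  also have "\<dots> = (\<integral>\<^sup>+\<omega>. f \<omega> \<partial>M) * (\<integral>\<^sup>+\<omega>. g \<omega> \<partial>M)"
    by (simp add: nn_integral_cmult nn_integral_multc)
  finally show ?thesis .
qed

lemma measurable_sub_algebra_mono: "A \<subseteq> B \<Longrightarrow> f \<in> measurable (sub_algebra A) N \<Longrightarrow> f \<in> measurable (sub_algebra B) N"
  by (rule measurable_sub_algebraI[where N = "sub_algebra A"])
     (auto simp: sets_sub_algebra intro!: sigma_sets_mono')

lemma nn_integral_prod_indep:
  assumes "finite V" and "disjoint_family_on I V"
    and "\<And>v. v \<in> V \<Longrightarrow> f v \<in> borel_measurable (sub_algebra (I v))"
  shows "(\<integral>\<^sup>+\<omega>. (\<Prod>v\<in>V. f v \<omega>) \<partial>M) = (\<Prod>v\<in>V. \<integral>\<^sup>+\<omega>. f v \<omega> \<partial>M)"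
  using assms
proof (induction V rule: finite_induct)
  case (insert v V)
  have "f w \<in> borel_measurable (sub_algebra (\<Union>u\<in>V. I u))" if "w \<in> V" for w
    by (rule measurable_sub_algebra_mono[OF _ insert.prems(2)]) (use that in auto)
  then have "(\<lambda>\<omega>. \<Prod>w\<in>V. f w \<omega>) \<in> borel_measurable (sub_algebra (\<Union>u\<in>V. I u))"
    by (intro borel_measurable_prod_ennreal) auto
  moreover have "I v \<inter> (\<Union>u\<in>V. I u) = {}"
    using insert.prems(1) insert.hyps by (fastforce simp: disjoint_family_on_def)
  ultimately have "(\<integral>\<^sup>+\<omega>. f v \<omega> * (\<Prod>w\<in>V. f w \<omega>) \<partial>M) = (\<integral>\<^sup>+\<omega>. f v \<omega> \<partial>M) * (\<integral>\<^sup>+\<omega>. (\<Prod>w\<in>V. f w \<omega>) \<partial>M)"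
    using insert.prems(2) by (intro nn_integral_mult_indep) auto
  moreover have "disjoint_family_on I V"
    using insert.prems(1) by (auto simp: disjoint_family_on_def)
  ultimately show ?case
    using insert by simp
qed (simp add: emeasure_space_1)

subsection \<open>Penalties of the nodes\<close>

lemma mean_power_pos: "0 < mean_power P j y"
  using tx_power_pos[of j] path_loss_pos[of j] height_pos[of j]
  by (auto simp: mean_power_def add_nonneg_pos intro!: mult_pos_pos)

lemma borel_measurable_mean_power [measurable]: "mean_power P j \<in> borel_measurable borel"
  unfolding mean_power_def[abs_def] by measurable

lemma borel_measurable_los_prob [measurable]: "los_prob P t \<in> borel_measurable borel"
  unfolding los_prob_def[abs_def] elevation_def[abs_def] by measurable

lemma borel_measurable_channel_intensity [measurable]:
  "channel_intensity P j \<in> borel_measurable borel"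
  unfolding channel_intensity_def[abs_def] channel_prob_def[abs_def] by measurable

lemma channel_prob_range: "0 \<le> y \<Longrightarrow> channel_prob P j y \<in> {0..1}"
  using los_prob_range[of y "tier_of j"] by (auto simp: channel_prob_def)

text \<open>The exclusion distance is obtained by solving the comparison of mean powers for the
  distance \<open>y\<close>; the chain of equivalences carries this out.\<close>

lemma mean_power_le_iff:
  assumes y: "0 \<le> y"
  shows "mean_power P j y \<le> mean_power P i r \<longleftrightarrow> excl_dist P i j r \<le> y"
proof -
  define a where "a = tx_power P j * path_loss P j"
  define b where "b = tx_power P i * path_loss P i"
  define u where "u = y\<^sup>2 + (height P j)\<^sup>2"
  define v where "v = (height P i)\<^sup>2 + r\<^sup>2"
  define \<alpha> where "\<alpha> = ple P j"
  define \<beta> where "\<beta> = ple P i"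
  have pos: "0 < a" "0 < b" "0 < u" "0 < v" "0 < \<alpha>" "0 < \<beta>"
    using tx_power_pos path_loss_pos height_pos[of i] height_pos[of j] ple_pos
    by (auto simp: a_def b_def u_def v_def \<alpha>_def \<beta>_def add_nonneg_pos add_pos_nonneg)
  have "mean_power P j y \<le> mean_power P i r \<longleftrightarrow> a * u powr (- (\<alpha> / 2)) \<le> b * v powr (- (\<beta> / 2))"
    by (simp add: mean_power_def a_def b_def u_def v_def \<alpha>_def \<beta>_def add.commute)
  also have "\<dots> \<longleftrightarrow> a / b * v powr (\<beta> / 2) \<le> u powr (\<alpha> / 2)"
    using pos by (simp add: powr_minus field_simps)
  \<comment> \<open>Raising to the power \<open>2 / \<alpha>\<close> is strictly increasing on
    positive numbers, so it preserves the comparison in both directions.\<close>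
  also have "\<dots> \<longleftrightarrow> (a / b) powr (2 / \<alpha>) * v powr (\<beta> / \<alpha>) \<le> u"
  proof -
    have "(a / b * v powr (\<beta> / 2)) powr (2 / \<alpha>) = (a / b) powr (2 / \<alpha>) * v powr (\<beta> / \<alpha>)"
      using pos by (subst powr_mult) (auto simp: powr_powr)
    moreover have "(u powr (\<alpha> / 2)) powr (2 / \<alpha>) = u"
      using pos by (simp add: powr_powr)
    moreover have "0 < a / b * v powr (\<beta> / 2)" "0 < u powr (\<alpha> / 2)" "0 < 2 / \<alpha>"
      using pos by auto
    ultimately show ?thesis
      by (metis less_eq_real_def powr_less_mono2 not_le)
  qed
  \<comment> \<open>Truncating at 0 changes nothing, since the right-hand side is a square.\<close>
  also have "\<dots> \<longleftrightarrow> max 0 ((a / b) powr (2 / \<alpha>) * v powr (\<beta> / \<alpha>) - (height P j)\<^sup>2) \<le> y\<^sup>2"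
    by (auto simp: u_def)
  also have "\<dots> \<longleftrightarrow> sqrt (max 0 ((a / b) powr (2 / \<alpha>) * v powr (\<beta> / \<alpha>) - (height P j)\<^sup>2)) \<le> sqrt (y\<^sup>2)"
    by (rule real_sqrt_le_iff[symmetric])
  also have "\<dots> \<longleftrightarrow> excl_dist P i j r \<le> y"
    using y by (simp add: excl_dist_def a_def b_def v_def \<alpha>_def \<beta>_def)
  finally show ?thesis .
qed

text \<open>The penalty is \<open>\<infinity>\<close> for a node that beats the serving node, so that \<open>exp_neg\<close> of the total
  penalty is \<open>exp (- s I)\<close> on the event that the central UAV serves and \<open>0\<close> elsewhere. Here \<open>c\<close> is
  the mean power of the serving node, \<open>y\<close> a distance and \<open>z\<close> a fading gain.\<close>

definition penalty :: "real \<Rightarrow> real \<Rightarrow> channel \<Rightarrow> real \<Rightarrow> real \<Rightarrow> ennreal" where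
  "penalty s c j y z =
     (if mean_power P j y \<le> c then ennreal s * ennreal (mean_power P j y * z) else \<infinity>)"

text \<open>The position \<open>x\<close> is an argument of its own rather than read off from
  \<open>\<omega>\<close>, so that it can be held fixed while blockage and fading are
  averaged.\<close>

definition node_penalty :: "real \<Rightarrow> real \<Rightarrow> tier \<Rightarrow> nat \<Rightarrow> real ^ 2 \<Rightarrow> 'w \<Rightarrow> ennreal" where
  "node_penalty s c t n x \<omega> =
     (if U t n \<omega> \<le> los_prob P t (norm x) then penalty s c (los t) (norm x) (G (los t) (Node t n) \<omega>)
      else penalty s c (nlos t) (norm x) (G (nlos t) (Node t n) \<omega>))"

text \<open>The Laplace transform at \<open>s\<close> of the power received from a
  type-\<open>j\<close> node at distance \<open>y\<close>, whose Gamma gain has shape and rate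
  \<open>nakagami P j\<close>.\<close>

definition fading_Laplace :: "real \<Rightarrow> channel \<Rightarrow> real \<Rightarrow> real" where
  "fading_Laplace s j y =
     (nakagami P j / (nakagami P j + s * mean_power P j y)) powr nakagami P j"

definition node_factor :: "real \<Rightarrow> real \<Rightarrow> channel \<Rightarrow> real \<Rightarrow> real" where
  "node_factor s c j y = (if mean_power P j y \<le> c then fading_Laplace s j y else 0)"

definition tier_factor :: "real \<Rightarrow> real \<Rightarrow> tier \<Rightarrow> real \<Rightarrow> real" where
  "tier_factor s c t y =
     los_prob P t y * node_factor s c (los t) y + (1 - los_prob P t y) * node_factor s c (nlos t) y"

lemma borel_measurable_fading_Laplace [measurable]: "fading_Laplace s j \<in> borel_measurable borel"
  unfolding fading_Laplace_def[abs_def] by measurable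

lemma borel_measurable_node_factor [measurable]: "node_factor s c j \<in> borel_measurable borel"
  unfolding node_factor_def[abs_def] by measurable

lemma borel_measurable_tier_factor [measurable]: "tier_factor s c t \<in> borel_measurable borel"
  unfolding tier_factor_def[abs_def] by measurable

lemma fading_Laplace_range:
  assumes "0 \<le> s"
  shows "0 \<le> fading_Laplace s j y" "fading_Laplace s j y \<le> 1"
proof -
  have "0 \<le> s * mean_power P j y"
    using assms mean_power_pos[of j y] by simp
  then show "0 \<le> fading_Laplace s j y" "fading_Laplace s j y \<le> 1"
    using nakagami_pos[of j] by (auto simp: fading_Laplace_def intro!: powr_le1)
qed

lemma node_factor_range:
  "0 \<le> s \<Longrightarrow> 0 \<le> node_factor s c j y" "0 \<le> s \<Longrightarrow> node_factor s c j y \<le> 1"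
  using fading_Laplace_range[of s j y] by (auto simp: node_factor_def)

lemma tier_factor_range:
  assumes "0 \<le> s" "0 \<le> y"
  shows "0 \<le> tier_factor s c t y" "tier_factor s c t y \<le> 1"
proof -
  have p: "0 \<le> los_prob P t y" "los_prob P t y \<le> 1"
    using los_prob_range[OF \<open>0 \<le> y\<close>, of t] by auto
  show "0 \<le> tier_factor s c t y"
    using p node_factor_range[OF \<open>0 \<le> s\<close>] by (auto simp: tier_factor_def)
  show "tier_factor s c t y \<le> 1"
    using p node_factor_range[OF \<open>0 \<le> s\<close>]
      convex_bound_le[of "node_factor s c (los t) y" 1 "node_factor s c (nlos t) y" "los_prob P t y" "1 - los_prob P t y"]
    by (auto simp: tier_factor_def)
qed

lemma measurable_penalty [measurable (raw)]:
  assumes [measurable]: "f \<in> borel_measurable N" "g \<in> borel_measurable N"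
  shows "(\<lambda>x. penalty s c j (f x) (g x)) \<in> borel_measurable N"
  unfolding penalty_def by measurable

lemma nn_integral_penalty:
  assumes s: "0 \<le> s"
  shows "(\<integral>\<^sup>+\<omega>. exp_neg (penalty s c j y (G j v \<omega>)) \<partial>M) = ennreal (node_factor s c j y)"
proof (cases "mean_power P j y \<le> c")
  case True
  \<comment> \<open>Where \<open>z \<le> 0\<close> the density vanishes, so it does not matter that
    \<open>ennreal\<close> truncates negative powers.\<close>
  have *: "gamma_density k b z * exp_neg (penalty s c j y z) = gamma_density k b z * exp (- (s * mean_power P j y * z))" for k b z
  proof (cases "z \<le> 0")
    case False
    then have "penalty s c j y z = ennreal (s * mean_power P j y * z)"
      using True s mean_power_pos[of j y] by (simp add: penalty_def ennreal_mult' mult.assoc)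
    then show ?thesis
      using False s mean_power_pos[of j y] by (simp add: exp_neg_ennreal)
  qed (simp add: gamma_density_def)
  have "(\<integral>\<^sup>+\<omega>. exp_neg (penalty s c j y (G j v \<omega>)) \<partial>M)
      = (\<integral>\<^sup>+z. ennreal (gamma_density (nakagami P j) (nakagami P j) z) * ennreal (exp_neg (penalty s c j y z)) \<partial>lborel)"
    by (subst distributed_nn_integral[OF fading]) auto
  also have "\<dots> = (\<integral>\<^sup>+z. ennreal (gamma_density (nakagami P j) (nakagami P j) z) * ennreal (exp (- (s * mean_power P j y * z))) \<partial>lborel)"
    by (simp add: * flip: ennreal_mult'')
  also have "\<dots> = ennreal (fading_Laplace s j y)"
    unfolding fading_Laplace_def
    using nakagami_pos[of j] s mean_power_pos[of j y] by (intro nn_integral_exp_gamma_density) auto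
  finally show ?thesis using True by (simp add: node_factor_def)
qed (simp add: penalty_def node_factor_def)

lemma prob_blockage_le:
  assumes "p \<in> {0..1}"
  shows "(\<integral>\<^sup>+\<omega>. indicator {..p} (U t n \<omega>) \<partial>M) = ennreal p"
    and "(\<integral>\<^sup>+\<omega>. indicator {p<..} (U t n \<omega>) \<partial>M) = ennreal (1 - p)"
proof -
  have "(\<integral>\<^sup>+\<omega>. indicator {..p} (U t n \<omega>) \<partial>M) = (\<integral>\<^sup>+u. indicator {0..1} u * indicator {..p} u \<partial>lborel)"
    by (subst distributed_nn_integral[OF blockage]) auto
  also have "\<dots> = (\<integral>\<^sup>+u. indicator {0..p} u \<partial>lborel)"
    using assms by (intro nn_integral_cong) (auto simp: indicator_def)
  finally show "(\<integral>\<^sup>+\<omega>. indicator {..p} (U t n \<omega>) \<partial>M) = ennreal p"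
    using assms by simp
  have "(\<integral>\<^sup>+\<omega>. indicator {p<..} (U t n \<omega>) \<partial>M) = (\<integral>\<^sup>+u. indicator {0..1} u * indicator {p<..} u \<partial>lborel)"
    by (subst distributed_nn_integral[OF blockage]) auto
  also have "\<dots> = (\<integral>\<^sup>+u. indicator {p<..1} u \<partial>lborel)"
    using assms by (intro nn_integral_cong) (auto simp: indicator_def)
  finally show "(\<integral>\<^sup>+\<omega>. indicator {p<..} (U t n \<omega>) \<partial>M) = ennreal (1 - p)"
    using assms by simp
qed

definition mark_sources :: "tier \<Rightarrow> nat \<Rightarrow> source set" where
  "mark_sources t n = {Blockage t n, Fading (los t) (Node t n), Fading (nlos t) (Node t n)}"

text \<open>General \<open>f\<close> and \<open>g\<close> cover three uses: a fixed position, a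
  random position on the same space, and position and marks taken from different factors of a
  product space.\<close>

lemma node_penalty_measurable_sub:
  assumes "mark_sources t n \<subseteq> A"
    and [measurable]: "f \<in> borel_measurable N" "g \<in> measurable N (sub_algebra A)"
  shows "(\<lambda>p. node_penalty s c t n (f p) (g p)) \<in> borel_measurable N"
proof -
  have "U t n \<in> borel_measurable (sub_algebra A)" "G (los t) (Node t n) \<in> borel_measurable (sub_algebra A)"
    "G (nlos t) (Node t n) \<in> borel_measurable (sub_algebra A)"
    using assms(1) by (auto simp: mark_sources_def intro!: blockage_measurable_sub fading_measurable_sub)
  then have [measurable]: "(\<lambda>p. U t n (g p)) \<in> borel_measurable N" "(\<lambda>p. G (los t) (Node t n) (g p)) \<in> borel_measurable N"
    "(\<lambda>p. G (nlos t) (Node t n) (g p)) \<in> borel_measurable N"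
    using measurable_compose[OF assms(3)] by blast+
  show ?thesis
    unfolding node_penalty_def by measurable
qed

lemma nn_integral_node_penalty:
  assumes s: "0 \<le> s"
  shows "(\<integral>\<^sup>+\<omega>. exp_neg (node_penalty s c t n x \<omega>) \<partial>M) = ennreal (tier_factor s c t (norm x))"
proof -
  define p where "p = los_prob P t (norm x)"
  have p: "p \<in> {0..1}" unfolding p_def by (rule los_prob_range) simp
  \<comment> \<open>In each summand the indicator depends on the blockage variable only and the
    other factor on a single gain, so their expectations multiply.\<close>
  have split: "ennreal (exp_neg (node_penalty s c t n x \<omega>))
      = indicator {..p} (U t n \<omega>) * ennreal (exp_neg (penalty s c (los t) (norm x) (G (los t) (Node t n) \<omega>)))
      + indicator {p<..} (U t n \<omega>) * ennreal (exp_neg (penalty s c (nlos t) (norm x) (G (nlos t) (Node t n) \<omega>)))" for \<omega>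
    by (simp add: node_penalty_def p_def indicator_def)
  have prod: "(\<integral>\<^sup>+\<omega>. indicator S (U t n \<omega>) * ennreal (exp_neg (penalty s c j (norm x) (G j (Node t n) \<omega>))) \<partial>M)
      = (\<integral>\<^sup>+\<omega>. indicator S (U t n \<omega>) \<partial>M) * ennreal (node_factor s c j (norm x))"
    if [measurable]: "S \<in> sets borel" for S :: "real set" and j
  proof -
    have [measurable]: "U t n \<in> borel_measurable (sub_algebra {Blockage t n})"
      "G j (Node t n) \<in> borel_measurable (sub_algebra {Fading j (Node t n)})"
      by (auto intro: blockage_measurable_sub fading_measurable_sub)
    show ?thesis
      unfolding nn_integral_penalty[OF s, symmetric, where v = "Node t n"]
      by (rule nn_integral_mult_indep[of "{Blockage t n}" "{Fading j (Node t n)}"]) (simp, measurable)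
  qed
  have "(\<integral>\<^sup>+\<omega>. exp_neg (node_penalty s c t n x \<omega>) \<partial>M)
      = ennreal p * ennreal (node_factor s c (los t) (norm x)) + ennreal (1 - p) * ennreal (node_factor s c (nlos t) (norm x))"
    unfolding split
    by (subst nn_integral_add) (auto simp: prod prob_blockage_le[OF p])
  also have "\<dots> = ennreal (tier_factor s c t (norm x))"
    using p node_factor_range[OF s] by (simp add: tier_factor_def p_def flip: ennreal_mult ennreal_plus)
  finally show ?thesis .
qed

section \<open>The total penalty of one tier\<close>

definition tier_sources :: "tier \<Rightarrow> source set" where
  "tier_sources t = insert (Position t) (\<Union>n. mark_sources t n)"

definition tier_penalty :: "real \<Rightarrow> real \<Rightarrow> tier \<Rightarrow> 'w \<Rightarrow> ennreal" where
  "tier_penalty s c t \<omega> = (\<Sum>n. node_penalty s c t n (X t n \<omega>) \<omega>)"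

lemma tier_penalty_measurable_sub: "tier_penalty s c t \<in> borel_measurable (sub_algebra (tier_sources t))"
proof -
  have [measurable]: "X t n \<in> borel_measurable (sub_algebra (tier_sources t))" for n
    by (rule position_measurable_sub) (simp add: tier_sources_def)
  show ?thesis
    unfolding tier_penalty_def[abs_def]
    by (intro borel_measurable_suminf_order node_penalty_measurable_sub[where A = "tier_sources t"])
       (auto simp: tier_sources_def intro!: position_measurable_sub)
qed

lemma tier_penalty_measurable [measurable]: "tier_penalty s c t \<in> borel_measurable M"
  using tier_penalty_measurable_sub by (rule measurable_from_sub_algebra)

text \<open>For the first \<open>N\<close> nodes, positions are decoupled from marks and the marks
  are integrated out node by node. Letting \<open>N\<close> grow on both sides then leaves a
  functional of the positions alone, to which the Laplace functional applies.\<close>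

lemma nn_integral_tier_penalty:
  assumes s: "0 \<le> s"
  shows "(\<integral>\<^sup>+\<omega>. exp_neg (tier_penalty s c t \<omega>) \<partial>M)
       = exp_neg (ennreal (intensity P t) * (\<integral>\<^sup>+x. ennreal (1 - tier_factor s c t (norm (x :: real ^ 2))) \<partial>lborel))"
proof -
  define A where "A = {Position t}"
  define B where "B = (\<Union>n. mark_sources t n)"
  have AB: "A \<inter> B = {}" by (auto simp: A_def B_def mark_sources_def)
  have markB: "mark_sources t n \<subseteq> B" for n by (auto simp: B_def)
  have [measurable]: "X t n \<in> borel_measurable (sub_algebra A)" for n
    by (rule position_measurable_sub) (simp add: A_def)
  have meas: "(\<lambda>\<omega>. node_penalty s c t n (X t n \<omega>) \<omega>) \<in> borel_measurable M" for n
    by (rule node_penalty_measurable_sub[OF markB]) (auto intro: measurable_id_sub_algebra)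
  have eq: "(\<integral>\<^sup>+\<omega>. (\<Prod>n<N. exp_neg (node_penalty s c t n (X t n \<omega>) \<omega>)) \<partial>M)
      = (\<integral>\<^sup>+\<omega>. (\<Prod>n<N. exp_neg (neg_ln (tier_factor s c t (norm (X t n \<omega>))))) \<partial>M)" for N
  proof -
    \<comment> \<open>The first outcome supplies the positions, the second the blockage and fading
      variables.\<close>
    define F where "F = (\<lambda>(\<omega>, \<omega>'). \<Prod>n<N. ennreal (exp_neg (node_penalty s c t n (X t n \<omega>) \<omega>')))"
    have "F \<in> borel_measurable (sub_algebra A \<Otimes>\<^sub>M sub_algebra B)"
    proof -
      have [measurable]: "(\<lambda>q. node_penalty s c t n (X t n (fst q)) (snd q)) \<in> borel_measurable (sub_algebra A \<Otimes>\<^sub>M sub_algebra B)" for n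
        by (rule node_penalty_measurable_sub[OF markB]) measurable
      show ?thesis
        unfolding F_def case_prod_beta' by measurable
    qed
    then have "(\<integral>\<^sup>+\<omega>. F (\<omega>, \<omega>) \<partial>M) = (\<integral>\<^sup>+\<omega>. \<integral>\<^sup>+\<omega>'. F (\<omega>, \<omega>') \<partial>M \<partial>M)"
      by (rule nn_integral_decouple[OF AB])
    also have "\<dots> = (\<integral>\<^sup>+\<omega>. (\<Prod>n<N. \<integral>\<^sup>+\<omega>'. exp_neg (node_penalty s c t n (X t n \<omega>) \<omega>') \<partial>M) \<partial>M)"
    proof (intro nn_integral_cong)
      fix \<omega>
      have "(\<integral>\<^sup>+\<omega>'. (\<Prod>n<N. ennreal (exp_neg (node_penalty s c t n (X t n \<omega>) \<omega>'))) \<partial>M)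
          = (\<Prod>n<N. \<integral>\<^sup>+\<omega>'. exp_neg (node_penalty s c t n (X t n \<omega>) \<omega>') \<partial>M)"
      proof (rule nn_integral_prod_indep[where I = "mark_sources t"])
        show "disjoint_family_on (mark_sources t) {..<N}"
          by (auto simp: disjoint_family_on_def mark_sources_def)
        fix n
        have "(\<lambda>\<omega>'. node_penalty s c t n (X t n \<omega>) \<omega>') \<in> borel_measurable (sub_algebra (mark_sources t n))"
          by (rule node_penalty_measurable_sub[where A = "mark_sources t n"]) auto
        then show "(\<lambda>\<omega>'. ennreal (exp_neg (node_penalty s c t n (X t n \<omega>) \<omega>'))) \<in> borel_measurable (sub_algebra (mark_sources t n))"
          by measurable
      qed simp
      then show "(\<integral>\<^sup>+\<omega>'. F (\<omega>, \<omega>') \<partial>M) = (\<Prod>n<N. \<integral>\<^sup>+\<omega>'. exp_neg (node_penalty s c t n (X t n \<omega>) \<omega>') \<partial>M)"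
        by (simp add: F_def)
    qed
    also have "\<dots> = (\<integral>\<^sup>+\<omega>. (\<Prod>n<N. exp_neg (neg_ln (tier_factor s c t (norm (X t n \<omega>))))) \<partial>M)"
      using tier_factor_range[OF s]
      by (simp add: nn_integral_node_penalty[OF s] exp_neg_neg_ln prod_ennreal)
    finally show ?thesis by (simp add: F_def prod_ennreal)
  qed
  have "(\<lambda>N. \<integral>\<^sup>+\<omega>. (\<Prod>n<N. exp_neg (node_penalty s c t n (X t n \<omega>) \<omega>)) \<partial>M)
      \<longlonglongrightarrow> (\<integral>\<^sup>+\<omega>. exp_neg (tier_penalty s c t \<omega>) \<partial>M)"
    unfolding tier_penalty_def by (rule nn_integral_exp_neg_suminf[OF meas])
  moreover have "(\<lambda>N. \<integral>\<^sup>+\<omega>. (\<Prod>n<N. exp_neg (neg_ln (tier_factor s c t (norm (X t n \<omega>))))) \<partial>M)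
      \<longlonglongrightarrow> (\<integral>\<^sup>+\<omega>. exp_neg (\<Sum>n. neg_ln (tier_factor s c t (norm (X t n \<omega>)))) \<partial>M)"
    by (rule nn_integral_exp_neg_suminf) measurable
  ultimately have "(\<integral>\<^sup>+\<omega>. exp_neg (tier_penalty s c t \<omega>) \<partial>M)
      = (\<integral>\<^sup>+\<omega>. exp_neg (\<Sum>n. neg_ln (tier_factor s c t (norm (X t n \<omega>)))) \<partial>M)"
    unfolding eq by (rule LIMSEQ_unique)
  also have "\<dots> = exp_neg (ennreal (intensity P t)
      * (\<integral>\<^sup>+x. ennreal (1 - exp_neg (neg_ln (tier_factor s c t (norm (x :: real ^ 2))))) \<partial>lborel))"
    using intensity_pos[of t]
    by (intro Laplace_functional_PPP[OF positions, where \<phi> = "\<lambda>x. neg_ln (tier_factor s c t (norm x))"]) auto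
  also have "\<dots> = exp_neg (ennreal (intensity P t) * (\<integral>\<^sup>+x. ennreal (1 - tier_factor s c t (norm (x :: real ^ 2))) \<partial>lborel))"
    using tier_factor_range[OF s] by (simp add: exp_neg_neg_ln)
  finally show ?thesis .
qed

end

subsection \<open>Total penalty and interference\<close>

lemma nn_integral_count_space_nodes:
  "(\<integral>\<^sup>+w. f w \<partial>count_space (- {Central})) = (\<Sum>n. f (Node UAV n)) + (\<Sum>n. f (Node TBS n))"
proof -
  have tier_sum: "(\<integral>\<^sup>+w\<in>range (Node t). f w \<partial>count_space UNIV) = (\<Sum>n. f (Node t n))" for t
  proof -
    have "(\<integral>\<^sup>+w\<in>range (Node t). f w \<partial>count_space UNIV) = (\<integral>\<^sup>+w. f w \<partial>count_space (range (Node t)))"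
      by (simp add: nn_integral_count_space_indicator)
    also have "\<dots> = (\<integral>\<^sup>+n. f (Node t n) \<partial>count_space UNIV)"
      by (intro nn_integral_bij_count_space[symmetric]) (auto simp: bij_betw_def inj_on_def)
    finally show ?thesis by (simp add: nn_integral_count_space_nat)
  qed
  have nodes: "- {Central} = range (Node UAV) \<union> range (Node TBS)"
  proof -
    have "w \<noteq> Central \<longleftrightarrow> w \<in> range (Node UAV) \<union> range (Node TBS)" for w
      by (cases w; cases "case w of Node t n \<Rightarrow> t | Central \<Rightarrow> UAV") auto
    then show ?thesis by blast
  qed
  have "(\<integral>\<^sup>+w. f w \<partial>count_space (- {Central}))
      = (\<integral>\<^sup>+w\<in>range (Node UAV) \<union> range (Node TBS). f w \<partial>count_space UNIV)"
    unfolding nodes by (simp add: nn_integral_count_space_indicator)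
  also have "\<dots> = (\<integral>\<^sup>+w\<in>range (Node UAV). f w \<partial>count_space UNIV) + (\<integral>\<^sup>+w\<in>range (Node TBS). f w \<partial>count_space UNIV)"
    by (rule nn_integral_disjoint_pair_countspace) auto
  finally show ?thesis by (simp add: tier_sum)
qed

context uav_network
begin

lemma interference_eq:
  "interference P X U G i r Central \<omega>
     = (\<Sum>n. ennreal (node_power P X U G i r (Node UAV n) \<omega>)) + (\<Sum>n. ennreal (node_power P X U G i r (Node TBS n) \<omega>))"
  unfolding interference_def by (rule nn_integral_count_space_nodes)

lemma node_power_measurable [measurable]: "node_power P X U G i r (Node t n) \<in> borel_measurable M"
proof -
  have eq: "node_power P X U G i r (Node t n) = (\<lambda>\<omega>. if U t n \<omega> \<le> los_prob P t (norm (X t n \<omega>))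
      then mean_power P (los t) (norm (X t n \<omega>)) * G (los t) (Node t n) \<omega>
      else mean_power P (nlos t) (norm (X t n \<omega>)) * G (nlos t) (Node t n) \<omega>)"
    by (auto simp: node_power_def node_mean_power_def)
  show ?thesis unfolding eq by measurable
qed

lemma interference_measurable [measurable]: "interference P X U G i r Central \<in> borel_measurable M"
proof -
  have "interference P X U G i r Central = (\<lambda>\<omega>. (\<Sum>n. ennreal (node_power P X U G i r (Node UAV n) \<omega>))
      + (\<Sum>n. ennreal (node_power P X U G i r (Node TBS n) \<omega>)))"
    by (simp add: interference_eq fun_eq_iff)
  then show ?thesis by simp
qed

text \<open>The parameters \<open>i\<close> and \<open>r\<close> occur on the right only: they
  describe the central UAV and have no influence on the other nodes.\<close>

lemma node_penalty_eq:
  "node_penalty s c t n (X t n \<omega>) \<omega>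
     = (if node_mean_power P X U i r (Node t n) \<omega> \<le> c
        then ennreal s * ennreal (node_power P X U G i r (Node t n) \<omega>) else \<infinity>)"
  by (simp add: node_penalty_def penalty_def node_power_def node_mean_power_def)

definition total_penalty :: "real \<Rightarrow> real \<Rightarrow> 'w \<Rightarrow> ennreal" where
  "total_penalty s c \<omega> = tier_penalty s c UAV \<omega> + tier_penalty s c TBS \<omega>"

lemma total_penalty_measurable [measurable]: "total_penalty s c \<in> borel_measurable M"
  unfolding total_penalty_def[abs_def] by measurable

lemma exp_neg_total_penalty:
  "exp_neg (total_penalty s (mean_power P i r) \<omega>)
     = (if serves P X U i r Central \<omega> then exp_neg (ennreal s * interference P X U G i r Central \<omega>) else 0)"
proof (cases "serves P X U i r Central \<omega>")
  case True
  then have le: "node_mean_power P X U i r w \<omega> \<le> mean_power P i r" for w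
    by (auto simp: serves_def node_mean_power_def)
  have "tier_penalty s (mean_power P i r) t \<omega> = ennreal s * (\<Sum>n. ennreal (node_power P X U G i r (Node t n) \<omega>))" for t
    using le by (simp add: tier_penalty_def node_penalty_eq[where i = i and r = r])
  then show ?thesis
    using True by (simp add: total_penalty_def interference_eq distrib_left)
next
  case False
  then obtain w where w: "\<not> node_mean_power P X U i r w \<omega> \<le> mean_power P i r"
    by (auto simp: serves_def node_mean_power_def)
  \<comment> \<open>The central UAV does not beat its own mean power, so the violating node belongs
    to a tier.\<close>
  then obtain t n where tn: "w = Node t n"
    by (cases w) (auto simp: node_mean_power_def)
  have "\<infinity> = node_penalty s (mean_power P i r) t n (X t n \<omega>) \<omega>"
    using w tn by (simp add: node_penalty_eq[where i = i and r = r])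
  also have "\<dots> \<le> tier_penalty s (mean_power P i r) t \<omega>"
    unfolding tier_penalty_def
    using sum_le_suminf[of "\<lambda>n. node_penalty s (mean_power P i r) t n (X t n \<omega>) \<omega>" "{n}"] by simp
  finally have "tier_penalty s (mean_power P i r) t \<omega> = \<infinity>"
    by (simp add: top_unique)
  then have "total_penalty s (mean_power P i r) \<omega> = \<infinity>"
    by (cases t) (auto simp: total_penalty_def)
  then show ?thesis using False by simp
qed

lemma nn_integral_total_penalty:
  "(\<integral>\<^sup>+\<omega>. exp_neg (total_penalty s c \<omega>) \<partial>M)
     = (\<integral>\<^sup>+\<omega>. exp_neg (tier_penalty s c UAV \<omega>) \<partial>M) * (\<integral>\<^sup>+\<omega>. exp_neg (tier_penalty s c TBS \<omega>) \<partial>M)"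
proof -
  note [measurable] = tier_penalty_measurable_sub
  have "tier_sources UAV \<inter> tier_sources TBS = {}"
    by (auto simp: tier_sources_def mark_sources_def)
  then have "(\<integral>\<^sup>+\<omega>. ennreal (exp_neg (tier_penalty s c UAV \<omega>)) * ennreal (exp_neg (tier_penalty s c TBS \<omega>)) \<partial>M)
     = (\<integral>\<^sup>+\<omega>. exp_neg (tier_penalty s c UAV \<omega>) \<partial>M) * (\<integral>\<^sup>+\<omega>. exp_neg (tier_penalty s c TBS \<omega>) \<partial>M)"
    by (rule nn_integral_mult_indep) measurable
  then show ?thesis by (simp add: total_penalty_def exp_neg_add ennreal_mult)
qed

section \<open>Splitting the exponent by channel type and at the exclusion distance\<close>

definition mean_closer_count :: "real \<Rightarrow> channel \<Rightarrow> ennreal" where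
  "mean_closer_count f j = ennreal (2 * pi) * (\<integral>\<^sup>+y\<in>{0..<f}. ennreal (channel_intensity P j y * y) \<partial>lborel)"

definition interference_exponent :: "real \<Rightarrow> real \<Rightarrow> channel \<Rightarrow> ennreal" where
  "interference_exponent s f j = ennreal (2 * pi) *
     (\<integral>\<^sup>+y\<in>{f..}. ennreal ((1 - fading_Laplace s j y) * channel_intensity P j y * y) \<partial>lborel)"

lemma channel_intensity_nonneg: "0 \<le> y \<Longrightarrow> 0 \<le> channel_intensity P j y"
  using channel_prob_range[of y j] intensity_pos[of "tier_of j"] by (simp add: channel_intensity_def)

text \<open>A bounded intensity on a bounded disc. Finiteness makes the void probability
  \<open>exp_neg (mean_closer_count f j)\<close> positive, so that it can be cancelled
  later.\<close>

lemma mean_closer_count_finite: "mean_closer_count f j < \<infinity>"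
proof -
  have "(\<integral>\<^sup>+y\<in>{0..<f}. ennreal (channel_intensity P j y * y) \<partial>lborel)
      \<le> (\<integral>\<^sup>+y\<in>{0..<f}. ennreal (intensity P (tier_of j) * f) \<partial>lborel)"
  proof (intro nn_integral_mono)
    fix y
    have "channel_intensity P j y * y \<le> intensity P (tier_of j) * f" if "0 \<le> y" "y < f"
      using that channel_prob_range[of y j] intensity_pos[of "tier_of j"]
      by (intro mult_mono) (auto simp: channel_intensity_def mult_left_le)
    then show "ennreal (channel_intensity P j y * y) * indicator {0..<f} y
        \<le> ennreal (intensity P (tier_of j) * f) * indicator {0..<f} y"
      by (auto simp: indicator_def intro!: ennreal_leI)
  qed
  also have "\<dots> < \<infinity>"
    by (subst nn_integral_cmult_indicator; cases "0 \<le> f") (auto simp: ennreal_mult_less_top)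
  finally show ?thesis
    by (auto simp: mean_closer_count_def ennreal_mult_less_top)
qed

lemma excl_dist_nonneg: "0 \<le> excl_dist P i j r"
  by (simp add: excl_dist_def)

text \<open>Below the exclusion distance \<open>node_factor\<close> is 0 and the integrand is the
  bare intensity, independent of \<open>s\<close>; beyond it the factor is the fading
  transform.\<close>

lemma nn_integral_node_factor:
  assumes s: "0 \<le> s"
  shows "ennreal (2 * pi) * (\<integral>\<^sup>+y\<in>{0..}. ennreal ((1 - node_factor s (mean_power P i r) j y) * channel_intensity P j y * y) \<partial>lborel)
       = mean_closer_count (excl_dist P i j r) j + interference_exponent s (excl_dist P i j r) j"
proof -
  define f where "f = excl_dist P i j r"
  have f: "0 \<le> f" by (simp add: f_def excl_dist_nonneg)
  have "(\<integral>\<^sup>+y\<in>{0..}. ennreal ((1 - node_factor s (mean_power P i r) j y) * channel_intensity P j y * y) \<partial>lborel)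
      = (\<integral>\<^sup>+y. ennreal (channel_intensity P j y * y) * indicator {0..<f} y
            + ennreal ((1 - fading_Laplace s j y) * channel_intensity P j y * y) * indicator {f..} y \<partial>lborel)"
    using f
    by (intro nn_integral_cong)
       (auto simp: node_factor_def mean_power_le_iff f_def[symmetric] indicator_def)
  also have "\<dots> = (\<integral>\<^sup>+y\<in>{0..<f}. ennreal (channel_intensity P j y * y) \<partial>lborel)
            + (\<integral>\<^sup>+y\<in>{f..}. ennreal ((1 - fading_Laplace s j y) * channel_intensity P j y * y) \<partial>lborel)"
    by (rule nn_integral_add) measurable
  finally show ?thesis
    by (simp add: mean_closer_count_def interference_exponent_def f_def distrib_left)
qed

lemma tier_exponent:
  assumes s: "0 \<le> s"
  shows "ennreal (intensity P t) * (\<integral>\<^sup>+x. ennreal (1 - tier_factor s (mean_power P i r) t (norm (x :: real ^ 2))) \<partial>lborel)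
       = (\<Sum>j\<in>{los t, nlos t}. mean_closer_count (excl_dist P i j r) j + interference_exponent s (excl_dist P i j r) j)"
proof -
  define c where "c = mean_power P i r"
  have tier: "tier_of (los t) = t" "tier_of (nlos t) = t" "los t \<noteq> nlos t"
    by (cases t; simp)+
  \<comment> \<open>The LOS and NLOS probabilities sum to 1, so \<open>1 - tier_factor\<close> is
    the same weighted average of the two terms \<open>1 - node_factor\<close>.\<close>
  have split: "ennreal (intensity P t) * (ennreal (1 - tier_factor s c t y) * ennreal y)
      = (\<Sum>j\<in>{los t, nlos t}. ennreal ((1 - node_factor s c j y) * channel_intensity P j y * y))"
    if y: "0 \<le> y" for y
  proof -
    have "intensity P t * ((1 - tier_factor s c t y) * y)
        = (\<Sum>j\<in>{los t, nlos t}. (1 - node_factor s c j y) * channel_intensity P j y * y)"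
      using tier by (simp add: tier_factor_def channel_intensity_def channel_prob_def algebra_simps)
    moreover have "0 \<le> (1 - node_factor s c j y) * channel_intensity P j y * y" for j
      using node_factor_range[OF s] channel_intensity_nonneg y by simp
    ultimately show ?thesis
      using y tier_factor_range[OF s y] intensity_pos[of t]
      by (simp add: ennreal_mult'[symmetric] del: sum.insert)
  qed
  have "ennreal (intensity P t) * (\<integral>\<^sup>+x. ennreal (1 - tier_factor s c t (norm (x :: real ^ 2))) \<partial>lborel)
      = ennreal (intensity P t) * (ennreal (2 * pi) * (\<integral>\<^sup>+y\<in>{0..}. ennreal (1 - tier_factor s c t y) * ennreal y \<partial>lborel))"
    by (subst nn_integral_norm_plane[where h = "\<lambda>y. ennreal (1 - tier_factor s c t y)"]) auto
  also have "\<dots> = ennreal (2 * pi) * (\<integral>\<^sup>+y. ennreal (intensity P t) * (ennreal (1 - tier_factor s c t y) * ennreal y * indicator {0..} y) \<partial>lborel)"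
    by (subst nn_integral_cmult) (auto simp: mult_ac)
  also have "\<dots> = ennreal (2 * pi) * (\<integral>\<^sup>+y. (\<Sum>j\<in>{los t, nlos t}.
      ennreal ((1 - node_factor s c j y) * channel_intensity P j y * y) * indicator {0..} y) \<partial>lborel)"
    using split by (intro arg_cong[where f = "\<lambda>z. ennreal (2 * pi) * z"] nn_integral_cong) (auto simp: indicator_def)
  also have "\<dots> = (\<Sum>j\<in>{los t, nlos t}. ennreal (2 * pi) *
      (\<integral>\<^sup>+y\<in>{0..}. ennreal ((1 - node_factor s c j y) * channel_intensity P j y * y) \<partial>lborel))"
    unfolding sum_distrib_left[symmetric]
    by (subst nn_integral_sum) auto
  also have "\<dots> = (\<Sum>j\<in>{los t, nlos t}. mean_closer_count (excl_dist P i j r) j + interference_exponent s (excl_dist P i j r) j)"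
    unfolding c_def nn_integral_node_factor[OF s] ..
  finally show ?thesis unfolding c_def .
qed

lemma nn_integral_exp_neg_total_penalty:
  assumes s: "0 \<le> s"
  shows "(\<integral>\<^sup>+\<omega>. exp_neg (total_penalty s (mean_power P i r) \<omega>) \<partial>M)
       = ennreal ((\<Prod>j\<in>{Lu, Nu, Lb, Nb}. exp_neg (mean_closer_count (excl_dist P i j r) j))
           * (\<Prod>j\<in>{Lu, Nu, Lb, Nb}. exp_neg (interference_exponent s (excl_dist P i j r) j)))"
  unfolding nn_integral_total_penalty nn_integral_tier_penalty[OF s] tier_exponent[OF s]
  by (simp add: exp_neg_add mult_ac flip: ennreal_mult)

lemma interference_exponent_0: "interference_exponent 0 f j = 0"
  using nakagami_pos[of j] by (simp add: interference_exponent_def fading_Laplace_def)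

lemma laplace_transform_interference:
  assumes s: "0 \<le> s"
  shows "laplace_transform (uniform_measure M {\<omega> \<in> space M. serves P X U i r Central \<omega>})
           (interference P X U G i r Central) s
       = (\<Prod>j\<in>{Lu, Nu, Lb, Nb}. exp_neg (interference_exponent s (excl_dist P i j r) j))"
proof -
  define A where "A = {\<omega> \<in> space M. serves P X U i r Central \<omega>}"
  define Q where "Q s = (\<Prod>j\<in>{Lu, Nu, Lb, Nb}. exp_neg (interference_exponent s (excl_dist P i j r) j))" for s
  define C where "C = (\<Prod>j\<in>{Lu, Nu, Lb, Nb}. exp_neg (mean_closer_count (excl_dist P i j r) j))"
  \<comment> \<open>\<open>C\<close> turns out to be the probability that the central UAV serves, so
    the conditioning is on an event of positive probability.\<close>
  have C: "0 < C"
    unfolding C_def using mean_closer_count_finite by (intro prod_pos) (auto simp: exp_neg_def less_top)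
  have Q: "0 \<le> Q s" by (simp add: Q_def)
  have ind: "ennreal (exp_neg (ennreal u * interference P X U G i r Central \<omega>)) * indicator A \<omega>
      = ennreal (exp_neg (total_penalty u (mean_power P i r) \<omega>))" if "\<omega> \<in> space M" for u \<omega>
    using that by (simp add: exp_neg_total_penalty A_def indicator_def)
  \<comment> \<open>At \<open>s = 0\<close> the expression is the indicator of the serving event,
    which yields measurability of that event.\<close>
  have "A = {\<omega> \<in> space M. exp_neg (total_penalty 0 (mean_power P i r) \<omega>) \<noteq> 0}"
    by (auto simp: A_def exp_neg_total_penalty)
  then have A [measurable]: "A \<in> sets M" by simp
  have *: "(\<integral>\<^sup>+\<omega>. ennreal (exp_neg (ennreal u * interference P X U G i r Central \<omega>)) * indicator A \<omega> \<partial>M) = ennreal (C * Q u)"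
    if "0 \<le> u" for u
    using that nn_integral_exp_neg_total_penalty[of u i r] by (simp add: ind C_def Q_def cong: nn_integral_cong)
  \<comment> \<open>At \<open>u = 0\<close> the exponential equals 1 even where the interference is
    infinite, because \<open>0 * \<infinity> = 0\<close>; hence the integral is the measure of
    \<open>A\<close>.\<close>
  have emA: "emeasure M A = ennreal C"
    using *[of 0] by (simp add: Q_def interference_exponent_0)
  have "laplace_transform (uniform_measure M A) (interference P X U G i r Central) s
      = enn2real (\<integral>\<^sup>+\<omega>. exp_neg (ennreal s * interference P X U G i r Central \<omega>) \<partial>uniform_measure M A)"
    unfolding laplace_transform_def by (rule integral_eq_nn_integral) auto
  also have "\<dots> = enn2real (ennreal (C * Q s) / ennreal C)"
    by (subst nn_integral_uniform_measure) (auto simp: *[OF s] emA)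
  also have "\<dots> = Q s"
    using C Q by (simp add: divide_ennreal)
  finally show ?thesis by (simp add: A_def Q_def)
qed

end

theorem lemma5:
  fixes P :: network
    and M :: "'w measure"
    and X :: "tier \<Rightarrow> nat \<Rightarrow> 'w \<Rightarrow> real ^ 2"
    and U :: "tier \<Rightarrow> nat \<Rightarrow> 'w \<Rightarrow> real"
    and G :: "channel \<Rightarrow> node \<Rightarrow> 'w \<Rightarrow> real"
    and i :: channel
    and r s :: real
  assumes "uav_network P M X U G"
    and "r \<ge> 0" and "i \<in> {Lu, Nu}" and "s \<ge> 0"
  shows "laplace_transform
           (uniform_measure M {\<omega> \<in> space M. serves P X U i r Central \<omega>})
           (interference P X U G i r Central) s
         = (\<Prod>j\<in>{Lu, Nu, Lb, Nb}.
              exp_neg (ennreal (2 * pi) *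
                (\<integral>\<^sup>+x\<in>{excl_dist P i j r..}.
                   ennreal ((1 - (nakagami P j /
                       (nakagami P j + s * tx_power P j * path_loss P j
                          * (x\<^sup>2 + (height P j)\<^sup>2) powr (- ple P j / 2))) powr nakagami P j)
                     * channel_intensity P j x * x) \<partial>lborel)))"
proof -
  interpret uav_network P M X U G by fact
  show ?thesis
    using laplace_transform_interference[OF \<open>s \<ge> 0\<close>, of i r]
    by (simp only: interference_exponent_def fading_Laplace_def mean_power_def mult.assoc)
qed

end
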